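(* For integers $n\ge 1$ let $$b_n = n(1-\gamma-H_{n-1})-\frac12+\sum_{k=2}^n \binom{n}{k}(-1)^k\zeta(k).$$ Then, as $n\to\infty$, $$b_n = \left( \frac{2n}{\pi}\right)^{1/4} e^{-2\sqrt{\pi n}}\cos\left(2\sqrt{\pi n}-\frac{5\pi}{8}\right)+O\left(e^{-2\sqrt{\pi n}}\,n^{-1/4}\right).$$
   Context: $\zeta$ is the Riemann zeta function, $\gamma$ is Euler's constant, and $H_n=1+\frac12+\cdots+\frac1n$ is the $n$th harmonic number, with $H_0=0$. The numbers $b_n$ are the coefficients of the Newton series $\sum_{n\ge0}(-1)^n b_n\binom{s}{n}$ associated to $\zeta(s)-\frac{1}{s-1}$. *)

theory Defs
  imports "HOL-Analysis.Analysis" "HOL-Library.Landau_Symbols"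
begin

(* The Dirichlet series of the Riemann zeta function.  It converges, and hence the definition is
   meaningful, only for s > 1; only the values at integers s >= 2 are used. *)
definition zeta :: "real \<Rightarrow> real" where
  "zeta s = (\<Sum>m. 1 / real (Suc m) powr s)"

(* Meant for n >= 1.  The value at n = 0 is not the coefficient b_0 = 1/2 of the Newton series. *)
definition newton_coeff :: "nat \<Rightarrow> real" where
  "newton_coeff n = real n * (1 - euler_mascheroni - harm (n - 1)) - 1 / 2
         + (\<Sum>k=2..n. real (n choose k) * (-1) ^ k * zeta (real k))"

end

(* With f t = (t / (1 + t)) ^ n, Euler-Maclaurin summation turns newton_coeff n into the limit of the integrals of
   f' against the sawtooth function over [0, M + 1/2].  The sawtooth is -1/pi times the boundary value of
   Im (Ln (1 - r * exp (- 2 pi i t))) as r tends to 1 from below; for r < 1 this kernel is holomorphic in the closed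
   lower half plane, so the path of integration can be moved onto the ray t = -1/2 + s (1 - i), the path of steepest
   descent through the saddle point s = sqrt (n / (4 pi)).  There only the linear term of the logarithm matters, and
   in u = t + 1/2 the function ln (1 + 1/t) = 1/u + O(1/u^3) is odd.  So f' is replaced by n u^(-2) exp (- n / u) at a
   relative cost O(n^(-1/2)), and the remaining integral, a Bessel function K_1, is a complex Gaussian in the variable
   sqrt (2 pi s) - sqrt (n / (2 s)) up to the same relative error. *)

theory Submission
  imports Defs "HOL-Complex_Analysis.Complex_Analysis" "HOL-Probability.Probability" "HOL-Real_Asymp.Real_Asymp"
begin

section \<open>Summation against the sawtooth function\<close>

text \<open>At r = 1 the kernel has logarithmic singularities at the integers, on the path itself.
  For r < 1 they move up to height - ln r / (2 pi), so the contour work is done for r < 1 with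
  bounds uniform in r; then r tends to 1 for a fixed cut-off M, and M tends to infinity last. A
  half-integer cut-off serves twice: the boundary term of the summation formula vanishes there, and
  exp (- 2 pi i t) is negative on the vertical line through it, which keeps the logarithm small. The
  ray is entered at - i/2; the piece from 0 to - i/2 costs O(n 2^(-n)). On the ray both 1/u and 2 pi
  i u are real multiples of 1 + i, so the exponent is - (1 + i) (n / (2 s) + 2 pi s). Moduli are
  thus governed by a real function with minimum 2 sqrt (pi n), and the phase 5 pi / 8 comes from the
  argument pi / 8 of the square root of 1 + i. The allowed relative error is only n^(-1/2), so the
  error bounds must keep the exact rate exp (- 2 sqrt (pi n)) and may lose only bounded
  factors.\<close>

lemma DERIV_primitive_one_minus_inverse_power:
  fixes x :: real
  assumes "x > 0"
  shows "((\<lambda>x. x - real n * ln x + (\<Sum>k<n. \<Sum>j<k. (1 - 1 / x) ^ Suc j / real (Suc j)))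
           has_real_derivative (1 - 1 / x) ^ n) (at x)"
proof -
  have "((\<lambda>x. x - real n * ln x + (\<Sum>k<n. \<Sum>j<k. (1 - 1 / x) ^ Suc j / real (Suc j)))
           has_real_derivative
         (1 - real n / x + (\<Sum>k<n. \<Sum>j<k. (1 - 1 / x) ^ j / x\<^sup>2))) (at x)"
  proof -
    have *: "((\<lambda>x. (1 - 1 / x) ^ Suc j / real (Suc j)) has_real_derivative (1 - 1 / x) ^ j / x\<^sup>2) (at x)" for j
    proof -
      have "((\<lambda>x. 1 - 1 / x) has_real_derivative 1 / x\<^sup>2) (at x)"
        using assms by (auto intro!: derivative_eq_intros simp: power2_eq_square)
      from DERIV_cdivide[OF DERIV_power_Suc[OF this, of j], of "real (Suc j)"] show ?thesis
        by (rule DERIV_cong) (use nonzero_mult_div_cancel_left[of "1 + real j"] in simp)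
    qed
    have "((\<lambda>x. \<Sum>k<n. \<Sum>j<k. (1 - 1 / x) ^ Suc j / real (Suc j)) has_real_derivative
            (\<Sum>k<n. \<Sum>j<k. (1 - 1 / x) ^ j / x\<^sup>2)) (at x)"
      by (intro DERIV_sum *)
    from DERIV_add[OF DERIV_diff[OF DERIV_ident DERIV_cmult[OF DERIV_ln_divide[OF assms], of "real n"]] this]
    show ?thesis by simp
  qed
  \<comment> \<open>With q = 1 - 1/x two geometric sums are at work: 1 - q^k = (1/x) (1 + ... +
    q^(k-1)) collapses the inner sum, and the same identity for n leaves q^n. The primitive is
    written in powers of q because q has derivative 1/x^2.\<close>
  also have "(\<Sum>k<n. \<Sum>j<k. (1 - 1 / x) ^ j / x\<^sup>2) = (\<Sum>k<n. (1 - (1 - 1 / x) ^ k) / x)"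
  proof (rule sum.cong [OF refl])
    fix k
    have "1 - (1 - 1 / x) ^ k = (1 / x) * (\<Sum>j<k. (1 - 1 / x) ^ j)"
      by (subst one_diff_power_eq) simp
    then show "(\<Sum>j<k. (1 - 1 / x) ^ j / x\<^sup>2) = (1 - (1 - 1 / x) ^ k) / x"
      using assms by (simp add: sum_divide_distrib[symmetric] power2_eq_square)
  qed
  also have "\<dots> = real n / x - (1 / x) * (\<Sum>k<n. (1 - 1 / x) ^ k)"
    by (simp add: diff_divide_distrib sum_subtractf sum_divide_distrib)
  also have "(1 / x) * (\<Sum>k<n. (1 - 1 / x) ^ k) = 1 - (1 - 1 / x) ^ n"
    by (subst one_diff_power_eq) simp
  finally show ?thesis by simp
qed

lemma integral_ratio_power:
  assumes "T \<ge> 0"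
  shows "((\<lambda>t. (t / (1 + t)) ^ n) has_integral
           T - real n * ln (1 + T) + (\<Sum>k<n. \<Sum>j<k. (1 - 1 / (1 + T)) ^ Suc j / real (Suc j))) {0..T}"
proof -
  let ?\<Phi> = "\<lambda>x::real. x - real n * ln x + (\<Sum>k<n. \<Sum>j<k. (1 - 1 / x) ^ Suc j / real (Suc j))"
  have "((\<lambda>t. (1 - 1 / (1 + t)) ^ n) has_integral ?\<Phi> (1 + T) - ?\<Phi> (1 + 0)) {0..T}"
  proof (rule fundamental_theorem_of_calculus[OF assms])
    fix t assume "t \<in> {0..T}"
    then have "((\<lambda>t. ?\<Phi> (1 + t)) has_real_derivative (1 - 1 / (1 + t)) ^ n * 1) (at t within {0..T})"
      by (intro DERIV_chain2[OF DERIV_primitive_one_minus_inverse_power]) (auto intro!: derivative_eq_intros)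
    then show "((\<lambda>t. ?\<Phi> (1 + t)) has_vector_derivative (1 - 1 / (1 + t)) ^ n) (at t within {0..T})"
      by (simp add: has_real_derivative_iff_has_vector_derivative)
  qed
  also have "?\<Phi> (1 + T) - ?\<Phi> (1 + 0) = T - real n * ln (1 + T) + (\<Sum>k<n. \<Sum>j<k. (1 - 1 / (1 + T)) ^ Suc j / real (Suc j))"
    by simp
  finally show ?thesis
    by (rule has_integral_cong[THEN iffD1, rotated]) (auto simp: field_simps)
qed

lemma sum_harm: "(\<Sum>k<Suc n. harm k) = real (Suc n) * harm n - real n"
proof (induction n)
  case 0
  then show ?case by (simp add: harm_def)
next
  case (Suc n)
  have "harm (Suc n) = harm n + 1 / real (Suc n)"
    by (simp add: harm_Suc field_simps)
  with Suc show ?case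
    by (simp add: field_simps)
qed

lemma zeta_sums:
  assumes "k \<ge> 2"
  shows "(\<lambda>m. 1 / real (Suc m) ^ k) sums zeta (real k)"
proof -
  have "summable (\<lambda>m. 1 / real (Suc m) ^ k)"
    using inverse_power_summable[of k, where 'a=real] assms
    by (subst summable_Suc_iff) (auto simp: field_simps)
  then show ?thesis
    by (simp add: zeta_def powr_realpow summable_sums del: of_nat_Suc)
qed

text \<open>Binomial expansion of each term and exchange of a finite sum with convergent series. The
  terms k = 0 and k = 1, whose series diverge, are moved to the other side.\<close>

lemma zeta_binomial_sum:
  assumes "n \<ge> 1"
  shows "(\<lambda>m. (1 - 1 / real (Suc m)) ^ n - 1 + real n / real (Suc m)) sums
           (\<Sum>k=2..n. real (n choose k) * (-1) ^ k * zeta (real k))"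
proof -
  have "(\<lambda>m. \<Sum>k=2..n. real (n choose k) * (-1) ^ k * (1 / real (Suc m) ^ k)) sums
           (\<Sum>k=2..n. real (n choose k) * (-1) ^ k * zeta (real k))"
    by (intro sums_sum sums_mult zeta_sums) auto
  moreover have "(\<Sum>k=2..n. real (n choose k) * (-1) ^ k * (1 / real (Suc m) ^ k)) =
      (1 - 1 / real (Suc m)) ^ n - 1 + real n / real (Suc m)" for m
  proof -
    have "(1 - 1 / real (Suc m)) ^ n = ((- 1 / real (Suc m)) + 1) ^ n"
      by simp
    also have "\<dots> = (\<Sum>k\<le>n. real (n choose k) * (- 1 / real (Suc m)) ^ k)"
      by (subst binomial_ring) simp
    also have "{..n} = insert 0 (insert 1 {2..n})"
      using assms by auto
    also have "(\<Sum>k\<in>\<dots>. real (n choose k) * (- 1 / real (Suc m)) ^ k) =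
      1 - real n / real (Suc m) + (\<Sum>k=2..n. real (n choose k) * (- 1 / real (Suc m)) ^ k)"
      by simp
    also have "(\<Sum>k=2..n. real (n choose k) * (- 1 / real (Suc m)) ^ k) =
       (\<Sum>k=2..n. real (n choose k) * (-1) ^ k * (1 / real (Suc m) ^ k))"
      by (intro sum.cong refl) (metis mult.assoc mult_minus1 power_mult_distrib power_one_over
          times_divide_eq_right mult_1_right)
    finally show ?thesis by simp
  qed
  ultimately show ?thesis by simp
qed

text \<open>Since 1 - 1/(m+1) = m/(1+m), the series for the zeta sum becomes a sum of f(m) up to the
  divergent parts M + 1 and n H_(M+1). The integral up to M + 1/2 carries M + 1/2 and n ln (M +
  3/2); the difference leaves 1/2 and n times Euler's constant.\<close>

lemma newton_coeff_limit:
  assumes "n \<ge> 1"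
  shows "(\<lambda>M. (\<Sum>m\<le>M. (real m / (1 + real m)) ^ n) - integral {0..real M + 1/2} (\<lambda>t. (t / (1 + t)) ^ n))
           \<longlonglongrightarrow> newton_coeff n"
proof -
  define a where "a m = (1 - 1 / real (Suc m)) ^ n - 1 + real n / real (Suc m)" for m
  define Z where "Z = (\<Sum>k=2..n. real (n choose k) * (-1) ^ k * zeta (real k))"
  define R where "R M = (\<Sum>k<n. \<Sum>j<k. (1 - 1 / (real M + 3/2)) ^ Suc j / real (Suc j))" for M :: nat
  have eq: "(\<Sum>m\<le>M. (real m / (1 + real m)) ^ n) - integral {0..real M + 1/2} (\<lambda>t. (t / (1 + t)) ^ n) =
     (\<Sum>m\<le>M. a m) - real n * (harm (Suc M) - ln (real (Suc M)))
       + real n * (ln (real M + 3/2) - ln (real (Suc M))) + 1/2 - R M" for M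
  proof -
    have "(\<Sum>m\<le>M. (real m / (1 + real m)) ^ n) = (\<Sum>m\<le>M. a m + 1 - real n * (1 / real (Suc m)))"
    proof (rule sum.cong [OF refl])
      fix m
      have "real m / (1 + real m) = 1 - 1 / real (Suc m)" by (simp add: field_simps)
      then show "(real m / (1 + real m)) ^ n = a m + 1 - real n * (1 / real (Suc m))"
        by (simp add: a_def)
    qed
    also have "\<dots> = (\<Sum>m\<le>M. a m) + real (Suc M) - real n * (\<Sum>m\<le>M. 1 / real (Suc m))"
      by (simp add: sum.distrib sum_subtractf sum_distrib_left)
    also have "(\<Sum>m\<le>M. 1 / real (Suc m)) = harm (Suc M)"
      unfolding harm_def by (simp add: inverse_eq_divide lessThan_Suc_atMost[symmetric] sum.atLeast1_atMost_eq)
    finally have 1: "(\<Sum>m\<le>M. (real m / (1 + real m)) ^ n) = (\<Sum>m\<le>M. a m) + real (Suc M) - real n * harm (Suc M)" .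
    have "integral {0..real M + 1/2} (\<lambda>t. (t / (1 + t)) ^ n) = real M + 1/2 - real n * ln (real M + 3/2) + R M"
      using integral_unique[OF integral_ratio_power[of "real M + 1/2" n]]
      by (simp add: R_def add_ac)
    with 1 show ?thesis by (simp add: algebra_simps)
  qed
  have "(\<lambda>M. (\<Sum>m\<le>M. a m) - real n * (harm (Suc M) - ln (real (Suc M)))
       + real n * (ln (real M + 3/2) - ln (real (Suc M))) + 1/2 - R M)
     \<longlonglongrightarrow> Z - real n * euler_mascheroni + real n * 0 + 1/2 - (\<Sum>k<n. \<Sum>j<k. (1 - 0) ^ Suc j / real (Suc j))"
  proof (intro tendsto_intros)
    show "(\<lambda>M. \<Sum>m\<le>M. a m) \<longlonglongrightarrow> Z"
      using zeta_binomial_sum[OF assms] by (simp add: sums_def_le a_def Z_def)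
    show "(\<lambda>M. harm (Suc M) - ln (real (Suc M))) \<longlonglongrightarrow> euler_mascheroni"
      using LIMSEQ_Suc[OF euler_mascheroni_LIMSEQ] .
    show "(\<lambda>M. ln (real M + 3/2) - ln (real (Suc M))) \<longlonglongrightarrow> 0"
      by real_asymp
    have "(\<lambda>M. 1 / (real M + 3/2)) \<longlonglongrightarrow> 0"
      by real_asymp
    then show "R \<longlonglongrightarrow> (\<Sum>k<n. \<Sum>j<k. (1 - 0) ^ Suc j / real (Suc j))"
      unfolding R_def by (intro tendsto_intros) auto
  qed
  \<comment> \<open>As the upper limit grows, 1 - 1/x tends to 1 and the inner sums become harmonic
    numbers. Their sum n H_(n-1) - (n-1) supplies the remaining terms, and 1/2 - 1 gives the - 1/2
    of the coefficient.\<close>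
  also have "(\<Sum>k<n. \<Sum>j<k. (1 - 0) ^ Suc j / real (Suc j)) = (\<Sum>k<n. harm k)"
    by (simp add: harm_def inverse_eq_divide sum.atLeast1_atMost_eq)
  also have "\<dots> = real n * harm (n - 1) - real (n - 1)"
    using sum_harm[of "n - 1"] assms by simp
  also have "Z - real n * euler_mascheroni + real n * 0 + 1/2 - (real n * harm (n - 1) - real (n - 1)) = newton_coeff n"
    using assms by (simp add: newton_coeff_def Z_def algebra_simps of_nat_diff)
  finally show ?thesis by (simp only: eq)
qed

lemma ratio_power_deriv:
  fixes t :: "'a :: real_normed_field"
  assumes "1 + t \<noteq> 0"
  shows "((\<lambda>t. (t / (1 + t)) ^ n) has_field_derivative of_nat n * t ^ (n - 1) / (1 + t) ^ (n + 1)) (at t within S)"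
proof (cases n)
  case (Suc k)
  have "((\<lambda>t. t / (1 + t)) has_field_derivative 1 / (1 + t)\<^sup>2) (at t within S)"
    using assms by (auto intro!: derivative_eq_intros simp: power2_eq_square)
  from DERIV_power_Suc[OF this, of k] show ?thesis
    using assms by (simp add: Suc power_divide power2_eq_square mult_ac)
qed auto

text \<open>Half-angle form: 1 - cis (-2 \<theta>) = 2 sin \<theta> cis (pi/2 - \<theta>). For
  \<theta> strictly between 0 and pi the modulus is positive and the angle lies in the principal
  range, so it can be read off.\<close>

lemma Im_Ln_one_minus_cis:
  fixes t :: real and m :: nat
  assumes "real m < t" "t < real m + 1"
  shows "Im (Ln (1 - exp (- (2 * pi * \<i> * of_real t)))) = - pi * (t - real m - 1/2)"
proof -
  define \<theta> where "\<theta> = pi * (t - real m)"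
  have th: "0 < \<theta>" "\<theta> < pi" using assms by (auto simp: \<theta>_def)
  have "exp (- (2 * pi * \<i> * of_real t)) = cis (- 2 * pi * t)"
    by (simp add: cis_conv_exp algebra_simps)
  also have "\<dots> = cis (- 2 * \<theta>)"
  proof -
    have "- 2 * pi * t = - 2 * \<theta> - 2 * pi * real m"
      by (simp add: \<theta>_def algebra_simps)
    then show ?thesis
      by (simp only: cis_divide[symmetric] cis_multiple_2pi[OF Ints_of_nat]) simp
  qed
  finally have "1 - exp (- (2 * pi * \<i> * of_real t)) = 1 - cis (- 2 * \<theta>)"
    by simp
  also have "\<dots> = of_real (2 * sin \<theta>) * cis (pi / 2 - \<theta>)"
  proof (rule complex_eqI)
    show "Re (1 - cis (- 2 * \<theta>)) = Re (of_real (2 * sin \<theta>) * cis (pi / 2 - \<theta>))"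
      by (simp add: cos_double_sin cos_diff power2_eq_square)
    show "Im (1 - cis (- 2 * \<theta>)) = Im (of_real (2 * sin \<theta>) * cis (pi / 2 - \<theta>))"
      by (simp add: sin_double sin_diff)
  qed
  also have "\<dots> = exp (Complex (ln (2 * sin \<theta>)) (pi / 2 - \<theta>))"
  proof -
    have "exp (Complex (ln (2 * sin \<theta>)) (pi / 2 - \<theta>)) =
       of_real (exp (ln (2 * sin \<theta>))) * cis (pi / 2 - \<theta>)"
      by (simp only: exp_eq_polar complex.sel)
    then show ?thesis
      using sin_gt_zero[of \<theta>] th by simp
  qed
  also have "Ln \<dots> = Complex (ln (2 * sin \<theta>)) (pi / 2 - \<theta>)"
    by (rule Ln_exp) (use th in auto)
  finally show ?thesis by (simp add: \<theta>_def algebra_simps)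
qed

text \<open>At the integers, the limit of \<open>Im (Ln (1 - r * exp (- 2 pi i t)))\<close> for \<open>r\<close> tending to 1 is 0.\<close>

definition sawtooth :: "real \<Rightarrow> real" where
  "sawtooth t = (if t \<in> \<int> then 0 else frac t - 1 / 2)"

lemma sawtooth_eq:
  assumes "real m < t" "t < real m + 1"
  shows "sawtooth t = t - real m - 1 / 2"
proof -
  have "\<lfloor>t\<rfloor> = int m"
    using assms by (intro floor_unique) auto
  moreover from this have "t \<notin> \<int>"
    using assms by (metis floor_of_int Ints_cases of_int_of_nat_eq less_irrefl)
  ultimately show ?thesis by (simp add: sawtooth_def frac_def)
qed

section \<open>Euler-Maclaurin summation, cell by cell\<close>

lemma has_integral_sawtooth_cell:
  fixes f f' :: "real \<Rightarrow> real"
  assumes f: "\<And>t. t \<in> {real m..b} \<Longrightarrow> (f has_real_derivative f' t) (at t within {real m..b})"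
    and b: "real m \<le> b" "b \<le> real m + 1"
  shows "((\<lambda>t. f' t * sawtooth t) has_integral
           (b - real m - 1/2) * f b + f (real m) / 2 - integral {real m..b} f) {real m..b}"
proof -
  \<comment> \<open>Integration by parts with t - m - 1/2. The upper end b stays free because the
    last cell is cut at its midpoint.\<close>
  have "((\<lambda>t. f' t * (t - real m - 1/2) + f t) has_integral
      (b - real m - 1/2) * f b - (real m - real m - 1/2) * f (real m)) {real m..b}"
  proof (rule fundamental_theorem_of_calculus[OF b(1)])
    fix t assume "t \<in> {real m..b}"
    then have "((\<lambda>t. (t - real m - 1/2) * f t) has_real_derivative f' t * (t - real m - 1/2) + f t)
       (at t within {real m..b})"
      by (auto intro!: derivative_eq_intros f)
    then show "((\<lambda>t. (t - real m - 1/2) * f t) has_vector_derivative f' t * (t - real m - 1/2) + f t)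
       (at t within {real m..b})"
      by (simp add: has_real_derivative_iff_has_vector_derivative)
  qed
  moreover have "(f has_integral integral {real m..b} f) {real m..b}"
    by (intro integrable_integral integrable_continuous_real DERIV_continuous_on[OF f])
  ultimately have "((\<lambda>t. f' t * (t - real m - 1/2) + f t - f t) has_integral
      (b - real m - 1/2) * f b - (real m - real m - 1/2) * f (real m) - integral {real m..b} f) {real m..b}"
    by (rule has_integral_diff)
  then have "((\<lambda>t. f' t * (t - real m - 1/2)) has_integral
      (b - real m - 1/2) * f b + f (real m) / 2 - integral {real m..b} f) {real m..b}"
    by simp
  then show ?thesis
  proof (rule has_integral_spike_finite[of "{real m, real m + 1}", rotated 2])
    fix t assume "t \<in> {real m..b} - {real m, real m + 1}"
    then show "f' t * sawtooth t = f' t * (t - real m - 1/2)"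
      using b by (subst sawtooth_eq[of m]) auto
  qed auto
qed

text \<open>Every integer strictly between 0 and M receives half of its value from each adjacent
  cell. At 0 one half is missing, and the final half cell supplies the second half at M.\<close>

lemma has_integral_sawtooth:
  fixes f f' :: "real \<Rightarrow> real"
  assumes f: "\<And>t. t \<ge> 0 \<Longrightarrow> (f has_real_derivative f' t) (at t)"
  shows "((\<lambda>t. f' t * sawtooth t) has_integral
           (\<Sum>m\<le>M. f (real m)) - f 0 / 2 - integral {0..real M + 1/2} f) {0..real M + 1/2}"
proof -
  have f': "\<And>t S. t \<ge> 0 \<Longrightarrow> (f has_real_derivative f' t) (at t within S)"
    using f DERIV_subset by blast
  have int: "f integrable_on {a..b}" if "a \<ge> 0" for a b
    using that by (intro integrable_continuous_real DERIV_continuous_on[OF f']) auto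
  have "((\<lambda>t. f' t * sawtooth t) has_integral
           (\<Sum>m\<le>M. f (real m)) - f 0 / 2 - f (real M) / 2 - integral {0..real M} f) {0..real M}"
  proof (induction M)
    case 0
    then show ?case by (simp add: has_integral_refl)
  next
    case (Suc M)
    have "((\<lambda>t. f' t * sawtooth t) has_integral
           (real M + 1 - real M - 1/2) * f (real M + 1) + f (real M) / 2 - integral {real M..real M + 1} f)
           {real M..real M + 1}"
      by (rule has_integral_sawtooth_cell) (auto intro: f')
    note has_integral_combine[OF _ _ Suc this]
    moreover have "integral {0..real M + 1} f = integral {0..real M} f + integral {real M..real M + 1} f"
      by (rule Henstock_Kurzweil_Integration.integral_combine[symmetric]) (auto intro: int)
    ultimately show ?case
      by (simp add: algebra_simps)
  qed
  \<comment> \<open>The coefficient of f at the upper end M + 1/2 is zero, so the cut-off leaves no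
    boundary term.\<close>
  then have "((\<lambda>t. f' t * sawtooth t) has_integral
           (\<Sum>m\<le>M. f (real m)) - f 0 / 2 - f (real M) / 2 - integral {0..real M} f +
           ((real M + 1/2 - real M - 1/2) * f (real M + 1/2) + f (real M) / 2 - integral {real M..real M + 1/2} f))
           {0..real M + 1/2}"
  proof (rule has_integral_combine[rotated 2])
    show "((\<lambda>t. f' t * sawtooth t) has_integral
           (real M + 1/2 - real M - 1/2) * f (real M + 1/2) + f (real M) / 2 - integral {real M..real M + 1/2} f)
           {real M..real M + 1/2}"
      by (rule has_integral_sawtooth_cell) (auto intro: f')
  qed auto
  moreover have "integral {0..real M + 1/2} f = integral {0..real M} f + integral {real M..real M + 1/2} f"
      by (rule Henstock_Kurzweil_Integration.integral_combine[symmetric]) (auto intro: int)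
  ultimately show ?thesis by (simp add: algebra_simps)
qed

text \<open>The derivative of (t / (1 + t))^n. It is polymorphic so that one formula serves on the
  real axis against the sawtooth and on the complex path.\<close>

definition ratio_deriv :: "nat \<Rightarrow> 'a :: real_normed_field \<Rightarrow> 'a" where
  "ratio_deriv n t = of_nat n * t ^ (n - 1) / (1 + t) ^ (n + 1)"

lemma newton_coeff_sawtooth:
  assumes "n \<ge> 1"
  shows "(\<lambda>M. integral {0..real M + 1/2} (\<lambda>t. ratio_deriv n t * sawtooth t)) \<longlonglongrightarrow> newton_coeff n"
proof -
  have "integral {0..real M + 1/2} (\<lambda>t. ratio_deriv n t * sawtooth t) =
     (\<Sum>m\<le>M. (real m / (1 + real m)) ^ n) - integral {0..real M + 1/2} (\<lambda>t. (t / (1 + t)) ^ n)" for M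
  proof -
    have "((\<lambda>t. (t / (1 + t)) ^ n) has_real_derivative ratio_deriv n t) (at t)" if "t \<ge> 0" for t :: real
      using that unfolding ratio_deriv_def by (intro ratio_power_deriv) auto
    \<comment> \<open>The term f 0 / 2 disappears because (0 / (1 + 0))^n = 0 for n \<ge> 1.\<close>
    from integral_unique[OF has_integral_sawtooth[OF this]] show ?thesis
      using assms by simp
  qed
  with newton_coeff_limit[OF assms] show ?thesis by simp
qed

section \<open>The damped logarithm and its boundary values\<close>

lemma norm_exp_damped_less_1:
  assumes "0 \<le> r" "r < 1" "Im t \<le> 0"
  shows "norm (of_real r * exp (- (2 * pi * \<i> * t))) < 1"
proof -
  have "Re (- (2 * pi * \<i> * t)) = 2 * pi * Im t"
    by simp
  then have "norm (of_real r * exp (- (2 * pi * \<i> * t))) = r * exp (2 * pi * Im t)"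
    using assms(1) by (simp only: norm_mult norm_exp_eq_Re norm_of_real abs_of_nonneg)
  also have "exp (2 * pi * Im t) \<le> 1"
    using assms(3) by (simp add: mult_nonneg_nonpos)
  then have "r * exp (2 * pi * Im t) \<le> r * 1"
    using assms(1) by (rule mult_left_mono)
  finally show ?thesis using assms by simp
qed

lemma one_minus_not_nonpos_Reals:
  fixes z :: complex
  assumes "norm z < 1"
  shows "1 - z \<notin> \<real>\<^sub>\<le>\<^sub>0"
proof -
  have "Re z < 1"
    using assms complex_Re_le_cmod[of z] by linarith
  then show ?thesis by (simp add: complex_nonpos_Reals_iff)
qed

text \<open>Dominated convergence: the imaginary part of the principal logarithm is bounded by pi,
  even near the integers where its real part becomes unbounded as r tends to 1.\<close>

lemma sawtooth_integral_limit:
  fixes g :: "real \<Rightarrow> real" and r :: "nat \<Rightarrow> real"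
  assumes g: "continuous_on {0..T} g"
    and r: "\<And>k. 0 < r k" "\<And>k. r k < 1" "r \<longlonglongrightarrow> 1"
  shows "(\<lambda>k. Im (integral {0..T} (\<lambda>t. of_real (g t) * Ln (1 - of_real (r k) * exp (- (2 * pi * \<i> * of_real t))))))
           \<longlonglongrightarrow> - pi * integral {0..T} (\<lambda>t. g t * sawtooth t)"
proof -
  define L where "L k t = Ln (1 - of_real (r k) * exp (- (2 * pi * \<i> * of_real t)))" for k and t :: real
  have nonpos: "1 - of_real (r k) * exp (- (2 * pi * \<i> * of_real t)) \<notin> \<real>\<^sub>\<le>\<^sub>0" for k and t :: real
    using r by (intro one_minus_not_nonpos_Reals norm_exp_damped_less_1) (auto intro: less_imp_le)
  have contL: "continuous_on A (L k)" for k A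
    unfolding L_def using nonpos by (intro continuous_intros) auto
  have int: "(\<lambda>t. of_real (g t) * L k t) integrable_on {0..T}" for k
    by (intro integrable_continuous_real continuous_intros g contL)
  have "(\<lambda>k. integral {0..T} (\<lambda>t. g t * Im (L k t))) \<longlonglongrightarrow> integral {0..T} (\<lambda>t. g t * (- pi * sawtooth t))"
  proof (rule dominated_convergence(2))
    show "(\<lambda>t. g t * Im (L k t)) integrable_on {0..T}" for k
      by (intro integrable_continuous_real continuous_intros g contL)
    show "(\<lambda>t. \<bar>g t\<bar> * pi) integrable_on {0..T}"
      by (intro integrable_continuous_real continuous_intros g)
    show "norm (g t * Im (L k t)) \<le> \<bar>g t\<bar> * pi" for k t
    proof -
      have "1 - of_real (r k) * exp (- (2 * pi * \<i> * of_real t)) \<noteq> 0"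
        using nonpos[of k t] by auto
      then have "\<bar>Im (L k t)\<bar> \<le> pi"
        unfolding L_def by (metis abs_le_iff less_imp_le minus_le_iff mpi_less_Im_Ln Im_Ln_le_pi)
      then show ?thesis by (simp add: abs_mult mult_left_mono)
    qed
    show "(\<lambda>k. g t * Im (L k t)) \<longlonglongrightarrow> g t * (- pi * sawtooth t)" if t: "t \<in> {0..T}" for t
    proof -
      have "(\<lambda>k. Im (L k t)) \<longlonglongrightarrow> - pi * sawtooth t"
      proof (cases "t \<in> \<int>")
        case True
        have "2 * pi * \<i> * of_real t = of_real t * (of_real (2 * pi) * \<i>)"
          by simp
        also have "- \<dots> = \<i> * of_real (2 * pi * (- t))"
          by simp
        finally have "exp (- (2 * pi * \<i> * of_real t)) = cis (2 * pi * (- t))"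
          by (simp only: cis_conv_exp)
        also have "\<dots> = 1"
          using True by (intro cis_multiple_2pi) auto
        finally have "L k t = Ln (of_real (1 - r k))" for k
          by (simp add: L_def)
        then have "Im (L k t) = 0" for k
          using r(2)[of k] by (simp add: Ln_of_real del: of_real_diff)
        then show ?thesis using True by (simp add: sawtooth_def)
      next
        case False
        define m where "m = nat \<lfloor>t\<rfloor>"
        have m: "real m = of_int \<lfloor>t\<rfloor>"
          using t by (simp add: m_def)
        have "real m \<noteq> t"
          using False by auto
        then have m: "real m < t" "t < real m + 1"
          unfolding m by linarith+
        have "(\<lambda>k. L k t) \<longlonglongrightarrow> Ln (1 - of_real 1 * exp (- (2 * pi * \<i> * of_real t)))"
          unfolding L_def
        \<comment> \<open>The limit point 1 - exp (- 2 pi i t) has nonnegative real part and is zero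
          only for integral t, hence it avoids the branch cut of \<open>Ln\<close>.\<close>
        proof (intro tendsto_intros r)
          define z where "z = 1 - of_real 1 * exp (- (2 * pi * \<i> * of_real t))"
          have "Re (exp (- (2 * pi * \<i> * of_real t))) \<le> 1"
            using complex_Re_le_cmod[of "exp (- (2 * pi * \<i> * of_real t))"] by simp
          then have "Re z \<ge> 0" by (simp add: z_def)
          moreover have "z \<noteq> 0"
          proof
            assume "z = 0"
            then have "exp (- (2 * pi * \<i> * of_real t)) = 1" by (simp add: z_def)
            then obtain j :: int where "- (2 * pi * t) = of_int (2 * j) * pi"
              by (auto simp: exp_eq_1)
            then have "pi * t = pi * of_int (- j)" by (simp add: mult.commute)
            then have "t = of_int (- j)" by (metis mult_cancel_left pi_neq_zero)
            with False show False by (metis Ints_of_int)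
          qed
          ultimately show "z \<notin> \<real>\<^sub>\<le>\<^sub>0"
            by (auto simp: complex_nonpos_Reals_iff complex_eq_iff)
        qed
        then have "(\<lambda>k. Im (L k t)) \<longlonglongrightarrow> Im (Ln (1 - of_real 1 * exp (- (2 * pi * \<i> * of_real t))))"
          by (rule tendsto_Im)
        also have "Im (Ln (1 - of_real 1 * exp (- (2 * pi * \<i> * of_real t)))) = - pi * sawtooth t"
          using Im_Ln_one_minus_cis[OF m] sawtooth_eq[OF m] by simp
        finally show ?thesis .
      qed
      then show ?thesis by (rule tendsto_mult_left)
    qed
  qed
  moreover have "integral {0..T} (\<lambda>t. g t * Im (L k t)) = Im (integral {0..T} (\<lambda>t. of_real (g t) * L k t))" for k
    using integral_linear[OF int bounded_linear_Im, of k] by (simp add: o_def)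
  moreover have "integral {0..T} (\<lambda>t. g t * (- pi * sawtooth t)) = - pi * integral {0..T} (\<lambda>t. g t * sawtooth t)"
    by (subst integral_mult_right[symmetric]) (simp add: mult_ac)
  ultimately show ?thesis by (simp add: L_def)
qed

section \<open>Rotation of the path of integration\<close>

definition log_kernel :: "real \<Rightarrow> complex \<Rightarrow> complex" where
  "log_kernel r t = Ln (1 - of_real r * exp (- (2 * pi * \<i> * t)))"

definition integrand :: "nat \<Rightarrow> real \<Rightarrow> complex \<Rightarrow> complex" where
  "integrand n r t = ratio_deriv n t * log_kernel r t"

lemma has_integral_affine_path:
  fixes G F :: "complex \<Rightarrow> complex"
  assumes "x \<le> y" and "open U"
    and G: "\<And>z. z \<in> U \<Longrightarrow> (G has_field_derivative F z) (at z within U)"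
    and path: "\<And>s. s \<in> {x..y} \<Longrightarrow> a + of_real s * d \<in> U"
  shows "((\<lambda>s. F (a + of_real s * d) * d) has_integral G (a + of_real y * d) - G (a + of_real x * d)) {x..y}"
proof (rule fundamental_theorem_of_calculus[OF assms(1)])
  fix s assume s: "s \<in> {x..y}"
  have "(G has_field_derivative F (a + of_real s * d)) (at (a + of_real s * d))"
    by (metis G[OF path[OF s]] at_within_open[OF path[OF s] assms(2)])
  moreover have "((\<lambda>s. a + of_real s * d) has_vector_derivative d) (at s within {x..y})"
    by (auto intro!: derivative_eq_intros)
  ultimately show "((\<lambda>s. G (a + of_real s * d)) has_vector_derivative F (a + of_real s * d) * d) (at s within {x..y})"
    using field_vector_diff_chain_within[of "\<lambda>s. a + of_real s * d" d s "{x..y}" G "F (a + of_real s * d)"]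
    by (simp add: o_def has_field_derivative_at_within mult.commute)
qed

text \<open>The integrand has a primitive on a convex open set containing all four segments, so each
  integral is a difference of its values at two of the corners 0, - i/2, T - i (M + 1) and
  T.\<close>

lemma rotate_contour:
  fixes M :: nat
  assumes r: "0 < r" "r < 1"
  defines "T \<equiv> real M + 1 / 2"
  shows "integral {0..T} (\<lambda>t. integrand n r (of_real t)) =
      integral {0..1/2} (\<lambda>y. integrand n r (- (of_real y * \<i>)) * (- \<i>))
    + integral {1/2..real M + 1} (\<lambda>s. integrand n r (- 1/2 + of_real s * (1 - \<i>)) * (1 - \<i>))
    + integral {0..real M + 1} (\<lambda>y. integrand n r (of_real T - of_real y * \<i>)) * \<i>"
proof -
  \<comment> \<open>Height of the branch points above the real axis: the modulus of r exp (- 2 pi i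
    t) is exp (2 pi (Im t - \<delta>)). The margin puts the real segment inside an open domain; the
    condition Re t > -1 excludes the pole of \<open>ratio_deriv\<close>.\<close>
  define \<delta> where "\<delta> = - ln r / (2 * pi)"
  have \<delta>: "\<delta> > 0" using r by (simp add: \<delta>_def divide_neg_pos)
  define U where "U = {z. Re z > - 1} \<inter> {z. Im z < \<delta>}"
  have U: "open U" "convex U"
    unfolding U_def by (auto intro!: open_Int convex_Int open_halfspace_Re_gt open_halfspace_Im_lt
        convex_halfspace_Re_gt convex_halfspace_Im_lt)
  have "integrand n r holomorphic_on U"
  proof -
    have "1 - of_real r * exp (- (2 * pi * \<i> * t)) \<notin> \<real>\<^sub>\<le>\<^sub>0" if "t \<in> U" for t
    proof (rule one_minus_not_nonpos_Reals)
      have "Re (- (2 * pi * \<i> * t)) = 2 * pi * Im t"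
        by simp
      then have "norm (of_real r * exp (- (2 * pi * \<i> * t))) = exp (ln r) * exp (2 * pi * Im t)"
        using r by (simp only: norm_mult norm_exp_eq_Re norm_of_real) simp
      also have "\<dots> = exp (2 * pi * (Im t - \<delta>))"
        by (simp add: exp_add[symmetric] \<delta>_def field_simps)
      also have "\<dots> < 1"
        using that by (simp add: U_def mult_pos_neg)
      finally show "norm (of_real r * exp (- (2 * pi * \<i> * t))) < 1" .
    qed
    moreover have "1 + t \<noteq> 0" if "t \<in> U" for t
    proof
      assume "1 + t = 0"
      then have "t = - 1" by (simp add: add_eq_0_iff)
      then show False using that by (simp add: U_def)
    qed
    ultimately show ?thesis
      unfolding integrand_def log_kernel_def ratio_deriv_def
      by (intro holomorphic_intros) auto
  qed
  from holomorphic_convex_primitive'[OF U(2,1) this] obtain G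
    where G: "\<And>z. z \<in> U \<Longrightarrow> (G has_field_derivative integrand n r z) (at z within U)"
    by blast
  note path = has_integral_affine_path[OF _ U(1) G]
  have 1: "((\<lambda>t. integrand n r (0 + of_real t * 1) * 1) has_integral G (0 + of_real T * 1) - G (0 + of_real 0 * 1)) {0..T}"
    by (rule path) (use \<delta> in \<open>auto simp: U_def T_def\<close>)
  have 2: "((\<lambda>y. integrand n r (0 + of_real y * (- \<i>)) * (- \<i>)) has_integral
      G (0 + of_real (1/2) * (- \<i>)) - G (0 + of_real 0 * (- \<i>))) {0..1/2}"
    by (rule path) (use \<delta> in \<open>auto simp: U_def\<close>)
  have 3: "((\<lambda>s. integrand n r (- 1/2 + of_real s * (1 - \<i>)) * (1 - \<i>)) has_integral
      G (- 1/2 + of_real (real M + 1) * (1 - \<i>)) - G (- 1/2 + of_real (1/2) * (1 - \<i>))) {1/2..real M + 1}"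
    by (rule path) (use \<delta> in \<open>auto simp: U_def\<close>)
  have 4: "((\<lambda>y. integrand n r (of_real T + of_real y * (- \<i>)) * (- \<i>)) has_integral
      G (of_real T + of_real (real M + 1) * (- \<i>)) - G (of_real T + of_real 0 * (- \<i>))) {0..real M + 1}"
    by (rule path) (use \<delta> in \<open>auto simp: U_def T_def\<close>)
  have e: "- 1/2 + of_real (real M + 1) * (1 - \<i>) = of_real T + of_real (real M + 1) * (- \<i>)"
     "- 1/2 + of_real (1/2) * (1 - \<i>) = 0 + of_real (1/2) * (- \<i>)"
    by (simp_all add: T_def complex_eq_iff)
  have "integral {0..real M + 1} (\<lambda>y. integrand n r (of_real T - of_real y * \<i>)) * \<i> =
     - integral {0..real M + 1} (\<lambda>y. integrand n r (of_real T + of_real y * (- \<i>)) * (- \<i>))"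
    by (simp flip: integral_mult_left)
  also have "\<dots> = G (of_real T + of_real 0 * (- \<i>)) - G (of_real T + of_real (real M + 1) * (- \<i>))"
    unfolding integral_unique[OF 4] by simp
  finally show ?thesis
    using integral_unique[OF 1] integral_unique[OF 2] integral_unique[OF 3] e
    by simp
qed

lemma continuous_on_integrand:
  assumes "0 < r" "r < 1"
  shows "continuous_on {t. Im t \<le> 0 \<and> Re t \<ge> 0} (integrand n r)"
proof -
  have "1 + t \<noteq> 0" if "Re t \<ge> 0" for t
    using that by (auto simp: complex_eq_iff)
  moreover have "1 - of_real r * exp (- (2 * pi * \<i> * t)) \<notin> \<real>\<^sub>\<le>\<^sub>0" if "Im t \<le> 0" for t
    using that assms by (intro one_minus_not_nonpos_Reals norm_exp_damped_less_1) auto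
  ultimately show ?thesis
    unfolding integrand_def[abs_def] log_kernel_def ratio_deriv_def
    by (auto intro!: continuous_intros)
qed

text \<open>On this line exp (- 2 pi i t) = - exp (- 2 pi y), so the kernel is the real number ln (1
  + r exp (- 2 pi y)), which lies in [0, 1]. The derivative is at most n / (M + 1)^2 since |t| \<le>
  |1 + t|, and the segment has length M + 1.\<close>

lemma norm_integral_vertical_end_le:
  fixes M :: nat
  assumes r: "0 < r" "r < 1" and n: "n \<ge> 1"
  shows "norm (integral {0..real M + 1} (\<lambda>y. integrand n r (of_real (real M + 1/2) - of_real y * \<i>)))
           \<le> real n / (real M + 1)"
proof -
  have bound: "norm (integrand n r (of_real (real M + 1/2) - of_real y * \<i>)) \<le> real n / (real M + 1)\<^sup>2"
    if y: "y \<ge> 0" for y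
  proof -
    define t where "t = of_real (real M + 1/2) - of_real y * \<i>"
    have t: "Re t = real M + 1/2" "Im t = - y" by (simp_all add: t_def)
    have "- (2 * pi * \<i> * t) = of_real (- 2 * pi * y) + \<i> * of_real (- (2 * pi * (real M + 1/2)))"
      by (simp add: t_def algebra_simps)
    then have "exp (- (2 * pi * \<i> * t)) = of_real (exp (- 2 * pi * y)) * cis (- (2 * pi * (real M + 1/2)))"
      by (simp only: exp_add cis_conv_exp exp_of_real)
    also have "cis (- (2 * pi * (real M + 1/2))) = cis (2 * pi * (- real M)) * cis (- pi)"
      by (simp add: cis_mult algebra_simps)
    also have "\<dots> = - 1"
      by (subst cis_multiple_2pi) (auto simp: complex_eq_iff)
    finally have "log_kernel r t = Ln (of_real (1 + r * exp (- 2 * pi * y)))"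
      by (simp add: log_kernel_def)
    also have "\<dots> = of_real (ln (1 + r * exp (- 2 * pi * y)))"
      using r by (intro Ln_of_real) (auto intro!: add_pos_pos)
    finally have "norm (log_kernel r t) = \<bar>ln (1 + r * exp (- 2 * pi * y))\<bar>"
      by (simp only: norm_of_real)
    also have "\<dots> \<le> 1"
    proof -
      have "0 \<le> r * exp (- 2 * pi * y)" "r * exp (- 2 * pi * y) \<le> 1 * 1"
        using r y by (simp, intro mult_mono) auto
      moreover from this(1) have "0 \<le> ln (1 + r * exp (- 2 * pi * y))"
          "ln (1 + r * exp (- 2 * pi * y)) \<le> r * exp (- 2 * pi * y)"
        by (auto intro: ln_add_one_self_le_self)
      ultimately show ?thesis by linarith
    qed
    finally have 1: "norm (log_kernel r t) \<le> 1" .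
    have "norm t \<le> norm (1 + t)"
      unfolding cmod_def t by (intro real_sqrt_le_mono) (auto simp: t power2_eq_square algebra_simps)
    moreover have *: "norm (1 + t) \<ge> real M + 1"
      using abs_Re_le_cmod[of "1 + t"] by (simp add: t)
    ultimately have "norm t ^ (n - 1) * (real M + 1)\<^sup>2 \<le> norm (1 + t) ^ (n - 1) * norm (1 + t) ^ 2"
      by (intro mult_mono power_mono) auto
    also have "\<dots> = norm (1 + t) ^ (n + 1)"
      using n by (simp flip: power_add)
    finally have "norm t ^ (n - 1) * (real M + 1)\<^sup>2 \<le> norm (1 + t) ^ (n + 1)" .
    moreover have "norm (1 + t) ^ (n + 1) > 0"
      using * by (intro zero_less_power) linarith
    ultimately have "norm t ^ (n - 1) / norm (1 + t) ^ (n + 1) \<le> 1 / (real M + 1)\<^sup>2"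
      by (simp add: pos_divide_le_eq pos_le_divide_eq mult.commute)
    from mult_left_mono[OF this, of "real n"]
    have "norm (ratio_deriv n t) \<le> real n / (real M + 1)\<^sup>2"
      by (simp add: ratio_deriv_def norm_mult norm_divide norm_power)
    then show ?thesis
      using mult_mono[OF _ 1, of "norm (ratio_deriv n t)" "real n / (real M + 1)\<^sup>2"]
      by (simp add: integrand_def norm_mult t_def)
  qed
  have "continuous_on {0..real M + 1} (\<lambda>y. integrand n r (of_real (real M + 1/2) - of_real y * \<i>))"
    by (rule continuous_on_compose2[OF continuous_on_integrand[OF r]]) (auto intro!: continuous_intros)
  then have "(\<lambda>y. integrand n r (of_real (real M + 1/2) - of_real y * \<i>)) integrable_on {0..real M + 1}"
    by (rule integrable_continuous_real)
  then have "norm (integral {0..real M + 1} (\<lambda>y. integrand n r (of_real (real M + 1/2) - of_real y * \<i>)))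
      \<le> integral {0..real M + 1} (\<lambda>y. real n / (real M + 1)\<^sup>2)"
    by (rule integral_norm_bound_integral) (rule integrable_const_ivl, rule bound, simp)
  also have "\<dots> = real n / (real M + 1)"
    by (simp add: power2_eq_square)
  finally show ?thesis .
qed

text \<open>On the negative imaginary axis the kernel is real, and it is bounded by 1/y uniformly in
  r. The factor y^(n-1) of the derivative absorbs this singularity, and y \<le> 1/2 makes the piece
  exponentially small in n.\<close>

lemma norm_integral_initial_le:
  assumes r: "0 < r" "r < 1" and n: "n \<ge> 2"
  shows "norm (integral {0..1/2} (\<lambda>y. integrand n r (- (of_real y * \<i>)) * (- \<i>))) \<le> 2 * real n * (1/2) ^ n"
proof -
  have bound: "norm (integrand n r (- (of_real y * \<i>)) * (- \<i>)) \<le> real n * (1/2) ^ (n - 2)"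
    if y: "y \<in> {0..1/2}" for y
  proof (cases "y = 0")
    case True
    then show ?thesis using n by (simp add: integrand_def ratio_deriv_def power_0_left)
  next
    case False
    with y have y0: "y > 0" by simp
    define t where "t = - (of_real y * \<i>)"
    define x where "x = r * exp (- 2 * pi * y)"
    have "x \<le> 1 * exp (- 2 * pi * y)"
      unfolding x_def using r by (intro mult_right_mono) auto
    also have "1 + 2 * y \<le> exp (2 * pi * y)"
    proof -
      have "2 * y \<le> (2 * pi) * y"
        using pi_gt3 y0 by (intro mult_right_mono) auto
      then show ?thesis
        using exp_ge_add_one_self[of "2 * pi * y"] by linarith
    qed
    then have "1 * exp (- 2 * pi * y) \<le> 1 / (1 + 2 * y)"
      using y0 by (simp add: exp_minus divide_simps)
    \<comment> \<open>Chosen so that x \<le> 1 / (1 + y) yields 1 / (1 - x) - 1 \<le> 1 / y.\<close>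
    also have "1 / (1 + 2 * y) \<le> 1 / (1 + y)"
      using y0 by (intro divide_left_mono) auto
    finally have x: "x \<le> 1 / (1 + y)" "0 < x"
      using r by (auto simp: x_def)
    have x1: "x < 1" 
      using x(1) y0 by (rule_tac le_less_trans[OF x(1)]) (simp add: field_simps)
    have "log_kernel r t = Ln (of_real (1 - x))"
      by (simp add: log_kernel_def t_def x_def exp_of_real[symmetric] mult_ac)
    also have "\<dots> = of_real (ln (1 - x))"
      using x1 by (intro Ln_of_real) auto
    finally have "norm (log_kernel r t) = - ln (1 - x)"
      using x1 x(2) by (simp only: norm_of_real) simp
    also have "\<dots> = ln (1 / (1 - x))"
      using x1 by (simp add: ln_div)
    also have "\<dots> \<le> 1 / (1 - x) - 1"
      using x1 by (intro ln_le_minus_one) auto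
    also have "\<dots> \<le> 1 / y"
      using x x1 y0 by (simp add: divide_simps) (simp add: algebra_simps)
    finally have 1: "norm (log_kernel r t) \<le> 1 / y" .
    have "norm (1 + t) \<ge> 1"
      using abs_Re_le_cmod[of "1 + t"] by (simp add: t_def)
    then have "norm (1 + t) ^ (n + 1) \<ge> 1"
      by (rule one_le_power)
    then have "norm (ratio_deriv n t) \<le> real n * y ^ (n - 1) / 1"
      using y0 unfolding ratio_deriv_def norm_mult norm_divide norm_power
      by (intro frac_le) (auto simp: t_def norm_mult)
    with 1 have "norm (ratio_deriv n t) * norm (log_kernel r t) \<le> (real n * y ^ (n - 1)) * (1 / y)"
      using y0 by (intro mult_mono) auto
    also have "y ^ (n - 1) = y * y ^ (n - 2)"
      using n by (cases n; cases "n - 1") auto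
    also have "(real n * (y * y ^ (n - 2))) * (1 / y) = real n * y ^ (n - 2)"
      using y0 by simp
    also have "\<dots> \<le> real n * (1/2) ^ (n - 2)"
      using y by (intro mult_left_mono power_mono) auto
    finally show ?thesis
      by (simp add: integrand_def norm_mult t_def)
  qed
  have cont: "continuous_on {0..1/2} (\<lambda>y. integrand n r (- (of_real y * \<i>)) * (- \<i>))"
    by (intro continuous_intros continuous_on_compose2[OF continuous_on_integrand[OF r]]) auto
  have "norm (integral {0..1/2} (\<lambda>y. integrand n r (- (of_real y * \<i>)) * (- \<i>)))
      \<le> integral {0..1/2} (\<lambda>y::real. real n * (1/2) ^ (n - 2))"
    by (rule integral_norm_bound_integral[OF integrable_continuous_real[OF cont]]) (rule integrable_const_ivl, rule bound)
  also have "\<dots> = 2 * real n * ((1/2) ^ (n - 2) * (1/2)\<^sup>2)"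
    by (simp add: power2_eq_square)
  also have "(1/2) ^ (n - 2) * (1/2)\<^sup>2 = (1/2 :: real) ^ n"
    using n by (metis le_add_diff_inverse2 power_add)
  finally show ?thesis .
qed

section \<open>Estimates on the ray\<close>

definition ray :: "real \<Rightarrow> complex" where
  "ray s = - 1/2 + of_real s * (1 - \<i>)"

text \<open>With this choice the square of \<open>norm (ray s / (1 + ray s))\<close> is \<open>(stretch s - 1) / (stretch s + 1)\<close>.\<close>

definition stretch :: "real \<Rightarrow> real" where
  "stretch s = 2 * s + 1 / (4 * s)"

lemma stretch_bounds:
  assumes "s \<ge> 1/2"
  shows "2 * s \<le> stretch s" "stretch s \<le> 2 * s + 1/2" "stretch s \<le> 3 * s" "stretch s > 1"
proof -
  have "1 / (4 * s) \<le> 1/2" "1 / (4 * s) > 0"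
    using assms by (auto simp: field_simps)
  then show "2 * s \<le> stretch s" "stretch s \<le> 2 * s + 1/2" "stretch s \<le> 3 * s" "stretch s > 1"
    unfolding stretch_def using assms by linarith+
qed

text \<open>The inequality artanh x \<ge> x, in a form that also makes sense for x \<ge> 1.\<close>

lemma one_minus_over_one_plus_le_exp:
  fixes x :: real
  assumes "0 \<le> x"
  shows "(1 - x) / (1 + x) \<le> exp (- 2 * x)"
proof -
  have "exp (- 0) * (1 + 0) - exp 0 * (1 - 0) \<le> exp (- x) * (1 + x) - exp x * (1 - x)"
  proof (rule DERIV_nonneg_imp_nondecreasing[OF assms])
    fix y assume y: "0 \<le> y" "y \<le> x"
    have "((\<lambda>x. exp (- x) * (1 + x) - exp x * (1 - x)) has_real_derivative y * (exp y - exp (- y))) (at y)"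
      by (auto intro!: derivative_eq_intros simp: algebra_simps)
    then show "\<exists>d. ((\<lambda>x. exp (- x) * (1 + x) - exp x * (1 - x)) has_real_derivative d) (at y) \<and> 0 \<le> d"
      using y by (intro exI[of _ "y * (exp y - exp (- y))"] conjI) auto
  qed
  then have "exp x * (1 - x) \<le> exp (- x) * (1 + x)" by simp
  then have "exp (- x) * (exp x * (1 - x)) \<le> exp (- x) * (exp (- x) * (1 + x))"
    by (rule mult_left_mono) simp
  then have "1 - x \<le> exp (- 2 * x) * (1 + x)"
    by (simp add: mult.assoc[symmetric] exp_add[symmetric])
  then show ?thesis
    using assms by (simp add: pos_divide_le_eq)
qed

text \<open>The square of the ratio is (1 - x) / (1 + x) with x = 1 / stretch s, and the factor 2 in
  the exponential bound undoes the square. A constant lost in this exponent would later be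
  multiplied by n.\<close>

lemma norm_ray_ratio_le:
  assumes "s \<ge> 1/2"
  shows "norm (ray s / (1 + ray s)) \<le> exp (- (1 / stretch s))"
proof -
  have s: "s > 0" using assms by simp
  have X: "s * stretch s = 2 * s\<^sup>2 + 1/4"
    using s by (simp add: stretch_def power2_eq_square algebra_simps)
  have 1: "(norm (ray s))\<^sup>2 = s * (stretch s - 1)"
    unfolding cmod_power2 right_diff_distrib X by (simp add: ray_def power2_eq_square algebra_simps)
  have 2: "(norm (1 + ray s))\<^sup>2 = s * (stretch s + 1)"
    unfolding cmod_power2 distrib_left X by (simp add: ray_def power2_eq_square algebra_simps)
  have "(norm (ray s / (1 + ray s)))\<^sup>2 = (stretch s - 1) / (stretch s + 1)"
    using s by (simp add: norm_divide power_divide 1 2)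
  also have "\<dots> = (1 - 1 / stretch s) / (1 + 1 / stretch s)"
  proof -
    have "1 - 1 / stretch s = (stretch s - 1) / stretch s" "1 + 1 / stretch s = (stretch s + 1) / stretch s"
      using stretch_bounds(4)[OF assms] by (auto simp: field_simps)
    then show ?thesis
      using stretch_bounds(4)[OF assms] by simp
  qed
  also have "\<dots> \<le> exp (- 2 * (1 / stretch s))"
    using stretch_bounds(4)[OF assms] by (intro one_minus_over_one_plus_le_exp) auto
  also have "\<dots> = (exp (- (1 / stretch s)))\<^sup>2"
    by (simp add: exp_double[symmetric])
  finally show ?thesis
    by (rule power2_le_imp_le) simp
qed

lemma norm_ray_ratio_power_le:
  assumes "s \<ge> 1/2"
  shows "norm ((ray s / (1 + ray s)) ^ n) \<le> exp (- (real n / stretch s))"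
proof -
  have "norm ((ray s / (1 + ray s)) ^ n) \<le> exp (- (1 / stretch s)) ^ n"
    unfolding norm_power by (intro power_mono norm_ray_ratio_le assms) auto
  also have "\<dots> = exp (- (real n / stretch s))"
    by (simp flip: exp_of_nat_mult)
  finally show ?thesis .
qed

lemma ray_nz:
  assumes "s > 0"
  shows "ray s \<noteq> 0" "1 + ray s \<noteq> 0"
  using assms by (auto simp: ray_def complex_eq_iff)

lemma ray_times: "ray s * (1 + ray s) = - 2 * \<i> * of_real (s\<^sup>2) - 1/4"
  by (simp add: ray_def complex_eq_iff power2_eq_square algebra_simps)

lemma norm_ray_times_ge: "2 * s\<^sup>2 \<le> norm (ray s * (1 + ray s))"
  using abs_Im_le_cmod[of "ray s * (1 + ray s)"] unfolding ray_times by simp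

lemma ratio_deriv_ray:
  assumes "s > 0" "n \<ge> 1"
  shows "ratio_deriv n (ray s) = of_nat n * (ray s / (1 + ray s)) ^ n / (ray s * (1 + ray s))"
  using assms ray_nz[OF assms(1)] by (cases n) (auto simp: ratio_deriv_def power_divide simp del: of_nat_Suc)

text \<open>The linear term of the logarithm on the ray is \<open>- r * wave s\<close>. The offset -
  1/2 of the ray only contributes a sign to it.\<close>

definition wave :: "real \<Rightarrow> complex" where
  "wave s = exp (- (2 * pi * \<i> * ray s))"

lemma norm_wave: "norm (wave s) = exp (- (2 * pi * s))"
  by (simp add: wave_def ray_def)

section \<open>The remainder of the logarithm after its linear term\<close>

lemma exp_minus_pi_le_half: "exp (- pi) \<le> 1/2"
proof -
  have "2 \<le> exp pi"
    using exp_ge_add_one_self[of pi] pi_gt3 by linarith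
  then show ?thesis by (simp add: exp_minus divide_simps)
qed

lemma am_gm_div:
  fixes a b x :: real
  assumes "a \<ge> 0" "b \<ge> 0" "x > 0"
  shows "2 * sqrt (a * b) \<le> a / x + b * x"
proof -
  have "0 \<le> (sqrt (a / x) - sqrt (b * x))\<^sup>2" by simp
  also have "\<dots> = a / x + b * x - 2 * sqrt ((a / x) * (b * x))"
    using assms by (simp add: power2_diff mult.assoc flip: real_sqrt_mult)
  also have "(a / x) * (b * x) = a * b" using assms by simp
  finally show ?thesis by simp
qed

text \<open>The remainder is quadratic in \<open>wave\<close> and so decays like exp (- 4 pi s). One
  pi s is kept for integrability over s. The other 3 pi s is, up to the constant 3 pi / 4, at least
  (3 pi / 2) * stretch s, and the arithmetic-geometric mean inequality with n / stretch s gives a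
  rate 2 sqrt (3 pi n / 2) that beats 2 sqrt (pi n).\<close>

lemma norm_integrand_ray_linear_le:
  assumes r: "0 < r" "r < 1" and s: "s \<ge> 1/2" and n: "n \<ge> 1"
  shows "norm (integrand n r (ray s) + of_real r * (ratio_deriv n (ray s) * wave s)) \<le>
           4 * exp (3 * pi / 4) * real n * exp (- 2 * sqrt (3 * pi * real n / 2)) * exp (- pi * s)"
proof -
  define z where "z = - (of_real r * wave s)"
  have nz: "norm z \<le> exp (- (2 * pi * s))"
    using r by (simp add: z_def norm_mult norm_wave mult_left_le_one_le)
  also have "\<dots> \<le> exp (- pi)"
    using s mult_left_mono[OF s, of "2 * pi"] by simp
  also note exp_minus_pi_le_half
  finally have half: "norm z \<le> 1/2" .
  have "norm (log_kernel r (ray s) - z) \<le> (norm z)\<^sup>2 / (1 - norm z)"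
    using Ln_approx_linear[of z] half by (simp add: log_kernel_def z_def wave_def)
  also have "\<dots> \<le> (norm z)\<^sup>2 / (1/2)"
    using half by (intro divide_left_mono) auto
  also have "\<dots> \<le> (exp (- (2 * pi * s)))\<^sup>2 / (1/2)"
    using nz by (intro divide_right_mono power_mono) auto
  also have "\<dots> = 2 * exp (- (4 * pi * s))"
    by (simp add: exp_double[symmetric])
  finally have L: "norm (log_kernel r (ray s) - z) \<le> 2 * exp (- (4 * pi * s))" .
  have s2: "1/2 \<le> 2 * s\<^sup>2"
    using power_mono[OF s, of 2] by (simp add: power2_eq_square)
  have "norm (ratio_deriv n (ray s)) =
      real n * norm ((ray s / (1 + ray s)) ^ n) / norm (ray s * (1 + ray s))"
    using s n by (subst ratio_deriv_ray) (simp_all add: norm_mult norm_divide)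
  also have "\<dots> \<le> real n * exp (- (real n / stretch s)) / (1/2)"
    using norm_ray_times_ge[of s] s2 norm_ray_ratio_power_le[OF s, of n]
    by (intro frac_le mult_left_mono) auto
  finally have "norm (ratio_deriv n (ray s)) \<le> real n * exp (- (real n / stretch s)) / (1/2)" .
  then have G: "norm (ratio_deriv n (ray s)) \<le> 2 * real n * exp (- (real n / stretch s))"
    by simp
  have "integrand n r (ray s) + of_real r * (ratio_deriv n (ray s) * wave s) =
     ratio_deriv n (ray s) * (log_kernel r (ray s) - z)"
    by (simp add: integrand_def z_def algebra_simps)
  also have "norm \<dots> \<le> (2 * real n * exp (- (real n / stretch s))) * (2 * exp (- (4 * pi * s)))"
    unfolding norm_mult by (intro mult_mono G L) auto
  also have "\<dots> = 4 * real n * exp (- (real n / stretch s) - 4 * pi * s)"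
    by (simp add: exp_add[symmetric] exp_diff exp_minus field_simps)
  also have "\<dots> \<le> 4 * real n * exp (3 * pi / 4 - 2 * sqrt (3 * pi * real n / 2) - pi * s)"
  proof -
    have "real n * (3 * pi / 2) = 3 * pi * real n / 2" by simp
    then have "2 * sqrt (3 * pi * real n / 2) \<le> real n / stretch s + 3 * pi / 2 * stretch s"
      using stretch_bounds(4)[OF s] am_gm_div[of "real n" "3 * pi / 2" "stretch s"] by (simp add: mult_ac)
    moreover have "3 * pi / 2 * stretch s \<le> 3 * pi / 2 * (2 * s + 1/2)"
      using stretch_bounds(2)[OF s] by (intro mult_left_mono) auto
    moreover have "3 * pi / 2 * (2 * s + 1/2) = 4 * pi * s - pi * s + 3 * pi / 4"
      by (simp add: field_simps)
    ultimately have "- (real n / stretch s) - 4 * pi * s \<le> 3 * pi / 4 - 2 * sqrt (3 * pi * real n / 2) - pi * s"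
      by linarith
    then show ?thesis by (intro mult_left_mono) auto
  qed
  also have "\<dots> = 4 * exp (3 * pi / 4) * real n * exp (- 2 * sqrt (3 * pi * real n / 2)) * exp (- pi * s)"
    by (simp add: exp_add[symmetric] exp_diff exp_minus field_simps)
  finally show ?thesis .
qed

text \<open>In the variable \<open>saddle n x\<close> the exponent \<open>n / x + pi * x\<close> is exactly quadratic, with minimum \<open>2 * lam n\<close>;
  see \<open>saddle_square\<close>.\<close>

definition saddle :: "nat \<Rightarrow> real \<Rightarrow> real" where
  "saddle n x = sqrt (pi * x) - sqrt (real n / x)"

definition saddle' :: "nat \<Rightarrow> real \<Rightarrow> real" where
  "saddle' n x = (sqrt (pi * x) + sqrt (real n / x)) / (2 * x)"

definition lam :: "nat \<Rightarrow> real" where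
  "lam n = sqrt (pi * real n)"

lemma sqrt_mult_lam:
  assumes "x > 0"
  shows "sqrt (pi * x) * sqrt (real n / x) = lam n"
  using assms by (simp add: lam_def real_sqrt_mult[symmetric])

lemma saddle_square:
  assumes "x > 0"
  shows "(saddle n x)\<^sup>2 = real n / x + pi * x - 2 * lam n"
  using assms sqrt_mult_lam[OF assms, of n] by (simp add: saddle_def power2_diff)

text \<open>From (a + b)^2 = (a - b)^2 + 4 a b with a b = lam n. It bounds \<open>saddle'\<close>
  below by sqrt (lam n) / x, the source of the factor 1 / sqrt (lam n) in
  \<open>saddle_weight_le\<close>.\<close>

lemma saddle_sum_ge:
  assumes "x > 0"
  shows "2 * sqrt (lam n) \<le> sqrt (pi * x) + sqrt (real n / x)"
proof (rule power2_le_imp_le)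
  have "(2 * sqrt (lam n))\<^sup>2 = 4 * lam n"
    by (simp add: power_mult_distrib lam_def)
  also have "\<dots> \<le> (saddle n x)\<^sup>2 + 4 * lam n" by simp
  also have "\<dots> = (sqrt (pi * x) + sqrt (real n / x))\<^sup>2"
    unfolding saddle_square[OF assms] using assms sqrt_mult_lam[OF assms, of n] by (simp add: power2_sum)
  finally show "(2 * sqrt (lam n))\<^sup>2 \<le> (sqrt (pi * x) + sqrt (real n / x))\<^sup>2" .
qed (use assms in auto)

lemma saddle_deriv:
  assumes "x > 0" "n \<ge> 1"
  shows "(saddle n has_real_derivative saddle' n x) (at x)"
proof -
  have "(saddle n has_real_derivative (pi / (2 * sqrt (pi * x)) + (real n / x\<^sup>2) / (2 * sqrt (real n / x)))) (at x)"
    unfolding saddle_def[abs_def] using assms mult_pos_pos[OF pi_gt_zero assms(1)]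
    by (auto intro!: derivative_eq_intros simp: power2_eq_square divide_simps mult_less_0_iff pi_not_less_zero)
  also have "pi / (2 * sqrt (pi * x)) = sqrt (pi * x) / (2 * x)"
  proof -
    have "pi * x > 0" using assms by simp
    then have "pi * (2 * x) = sqrt (pi * x) * (2 * sqrt (pi * x))" by simp
    with \<open>pi * x > 0\<close> show ?thesis using assms by (subst frac_eq_eq) auto
  qed
  also have "(real n / x\<^sup>2) / (2 * sqrt (real n / x)) = sqrt (real n / x) / (2 * x)"
  proof -
    have "real n / x\<^sup>2 = (sqrt (real n / x) * sqrt (real n / x)) / x"
      using assms by (simp add: power2_eq_square)
    moreover have "sqrt (real n / x) > 0" using assms by simp
    ultimately show ?thesis by (simp del: real_sqrt_mult_self real_sqrt_gt_0_iff)
  qed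
  finally show ?thesis by (simp add: saddle'_def add_divide_distrib)
qed

lemma saddle'_nonneg: "x > 0 \<Longrightarrow> 0 \<le> saddle' n x"
  by (simp add: saddle'_def)

text \<open>The fifth power of (1 + y) / 5 \<le> exp (y / 5). One power more than the four to be
  absorbed leaves the weight 1 / (1 + y), a Cauchy density when y is a square.\<close>

lemma power5_exp_le:
  fixes y :: real
  assumes "y \<ge> 0"
  shows "(1 + y) ^ 4 * exp (- y) \<le> 5 ^ 5 / (1 + y)"
proof -
  have "(1 + y) / 5 \<le> exp (y / 5)"
    by (rule order_trans[OF _ exp_ge_add_one_self[of "y / 5"]]) simp
  then have "((1 + y) / 5) ^ 5 \<le> exp (y / 5) ^ 5"
    using assms by (intro power_mono) auto
  also have "\<dots> = exp y" by (simp flip: exp_of_nat_mult)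
  finally have "(1 + y) ^ 5 \<le> 5 ^ 5 * exp y" by (simp add: power_divide)
  then have "(1 + y) ^ 4 * (1 + y) * exp (- y) \<le> 5 ^ 5 * exp y * exp (- y)"
    by (intro mult_right_mono) (auto simp: power_numeral_reduce)
  also have "\<dots> = 5 ^ 5" by (simp add: exp_minus)
  finally show ?thesis
    using assms by (simp add: pos_le_divide_eq mult_ac)
qed

lemma lam_ge_1: "n \<ge> 1 \<Longrightarrow> lam n \<ge> 1"
proof -
  assume "n \<ge> 1"
  then have "1 * 1 \<le> pi * real n"
    using pi_gt3 by (intro mult_mono) auto
  then show ?thesis by (simp add: lam_def)
qed

text \<open>Negative powers of x become powers of 1 + y: q = n / x is a part of the exponent y + 2
  lam n, hence at most 2 lam n (1 + y). Since lam n ^ 4 = pi^2 n^2, the powers of n cancel, and the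
  Gaussian absorbs (1 + y)^4. The constant 24 is 16 + 8 from q^4 and q^3.\<close>

lemma saddle_weight_le:
  assumes x: "x > 0" and n: "n \<ge> 1"
  shows "(real n / x ^ 4 + (real n)\<^sup>2 / x ^ 5) * exp (- (saddle n x)\<^sup>2)
           \<le> 24 * pi\<^sup>2 * 5 ^ 5 / sqrt (lam n) * (saddle' n x / (1 + (saddle n x)\<^sup>2))"
proof -
  define y where "y = (saddle n x)\<^sup>2"
  define q where "q = real n / x"
  have y: "y \<ge> 0" by (simp add: y_def)
  have lam: "lam n \<ge> 1" using n by (rule lam_ge_1)
  have q0: "q > 0" using x n by (simp add: q_def)
  have "q \<le> real n / x + pi * x" using x by (simp add: q_def)
  also have "\<dots> = y + 2 * lam n"
    unfolding y_def saddle_square[OF x] by simp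
  also have "\<dots> \<le> 2 * lam n * (1 + y)"
    using lam y mult_right_mono[of 1 "2 * lam n" y] by (simp add: distrib_left)
  finally have q: "q \<le> 2 * lam n * (1 + y)" .
  have lam4: "lam n ^ 4 = pi\<^sup>2 * (real n)\<^sup>2"
    using power_mult[of "lam n" 2 2] by (simp add: lam_def power_mult_distrib)
  have "q ^ 4 \<le> (2 * lam n * (1 + y)) ^ 4"
    using q0 q by (intro power_mono) auto
  then have q4: "q ^ 4 \<le> 16 * (pi\<^sup>2 * (real n)\<^sup>2) * (1 + y) ^ 4"
    by (simp add: power_mult_distrib lam4)
  have "q ^ 3 \<le> (2 * lam n * (1 + y)) ^ 3"
    using q0 q by (intro power_mono) auto
  also have "\<dots> = 8 * lam n ^ 3 * (1 + y) ^ 3"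
    by (simp add: power_mult_distrib)
  also have "\<dots> \<le> 8 * lam n ^ 4 * (1 + y) ^ 4"
    using lam y by (intro mult_mono power_increasing) auto
  finally have q3: "q ^ 3 \<le> 8 * (pi\<^sup>2 * (real n)\<^sup>2) * (1 + y) ^ 4"
    by (simp add: lam4)
  have w: "sqrt (lam n) / x \<le> saddle' n x"
    using saddle_sum_ge[OF x, of n] x by (simp add: saddle'_def field_simps)
  have "(real n / x ^ 4 + (real n)\<^sup>2 / x ^ 5) = (q ^ 3 + q ^ 4) / (real n)\<^sup>2 / sqrt (lam n) * (sqrt (lam n) / x)"
    using x n lam by (simp add: q_def field_simps power_numeral_reduce)
  also have "\<dots> \<le> (24 * (pi\<^sup>2 * (real n)\<^sup>2) * (1 + y) ^ 4) / (real n)\<^sup>2 / sqrt (lam n) * saddle' n x"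
    using q3 q4 w lam x q0 by (intro mult_mono divide_right_mono) auto
  also have "\<dots> = 24 * pi\<^sup>2 / sqrt (lam n) * saddle' n x * (1 + y) ^ 4"
    using n by simp
  finally have "(real n / x ^ 4 + (real n)\<^sup>2 / x ^ 5) * exp (- y) \<le>
    24 * pi\<^sup>2 / sqrt (lam n) * saddle' n x * (1 + y) ^ 4 * exp (- y)"
    by (intro mult_right_mono) auto
  also have "\<dots> = 24 * pi\<^sup>2 / sqrt (lam n) * saddle' n x * ((1 + y) ^ 4 * exp (- y))"
    by simp
  also have "\<dots> \<le> 24 * pi\<^sup>2 / sqrt (lam n) * saddle' n x * (5 ^ 5 / (1 + y))"
    using saddle'_nonneg[OF x] lam by (intro mult_left_mono power5_exp_le y) auto
  finally show ?thesis
    by (simp add: y_def mult_ac)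
qed

lemma norm_integral_ray_linear_le:
  assumes r: "0 < r" "r < 1" and n: "n \<ge> 1" and b: "b \<ge> 1/2"
  shows "norm (integral {1/2..b} (\<lambda>s. integrand n r (ray s) * (1 - \<i>))
             + of_real r * integral {1/2..b} (\<lambda>s. ratio_deriv n (ray s) * wave s * (1 - \<i>)))
           \<le> 8 * exp (3 * pi / 4) * real n * exp (- 2 * sqrt (3 * pi * real n / 2))"
proof -
  define K where "K = 4 * exp (3 * pi / 4) * real n * exp (- 2 * sqrt (3 * pi * real n / 2))"
  have K: "K \<ge> 0" by (simp add: K_def)
  have "1 + ray s \<noteq> 0" if "s \<ge> 1/2" for s
    using that by (intro ray_nz) auto
  then have cont2: "continuous_on {1/2..b} (\<lambda>s. ratio_deriv n (ray s) * wave s * (1 - \<i>))"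
    unfolding ratio_deriv_def wave_def by (auto simp: ray_def intro!: continuous_intros)
  have cont1: "continuous_on {1/2..b} (\<lambda>s. integrand n r (ray s) * (1 - \<i>))"
    by (intro continuous_intros continuous_on_compose2[OF continuous_on_integrand[OF r]])
       (auto simp: ray_def intro!: continuous_intros)
  note int = integrable_continuous_real[OF cont1] integrable_continuous_real[OF cont2]
  have "integral {1/2..b} (\<lambda>s. integrand n r (ray s) * (1 - \<i>))
       + of_real r * integral {1/2..b} (\<lambda>s. ratio_deriv n (ray s) * wave s * (1 - \<i>)) =
     integral {1/2..b} (\<lambda>s. integrand n r (ray s) * (1 - \<i>) + of_real r * (ratio_deriv n (ray s) * wave s * (1 - \<i>)))"
    using int by (subst integral_add) (auto intro!: integrable_on_mult_right)
  also have "norm \<dots> \<le> integral {1/2..b} (\<lambda>s. K * exp (- pi * s) * 2)"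
  proof (rule integral_norm_bound_integral)
    show "(\<lambda>s. integrand n r (ray s) * (1 - \<i>) + of_real r * (ratio_deriv n (ray s) * wave s * (1 - \<i>))) integrable_on {1/2..b}"
      by (intro integrable_continuous_real continuous_intros cont1 cont2)
    show "(\<lambda>s. K * exp (- pi * s) * 2) integrable_on {1/2..b}"
      by (intro integrable_continuous_real continuous_intros)
    fix s assume s: "s \<in> {1/2..b}"
    have "integrand n r (ray s) * (1 - \<i>) + of_real r * (ratio_deriv n (ray s) * wave s * (1 - \<i>)) =
        (integrand n r (ray s) + of_real r * (ratio_deriv n (ray s) * wave s)) * (1 - \<i>)"
      by (simp add: algebra_simps)
    moreover have "norm (1 - \<i>) \<le> 2"
      using norm_triangle_ineq4[of 1 \<i>] by simp
    moreover have "norm (integrand n r (ray s) + of_real r * (ratio_deriv n (ray s) * wave s)) \<le> K * exp (- pi * s)"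
      unfolding K_def using s by (intro norm_integrand_ray_linear_le r n) auto
    ultimately show "norm (integrand n r (ray s) * (1 - \<i>) + of_real r * (ratio_deriv n (ray s) * wave s * (1 - \<i>)))
        \<le> K * exp (- pi * s) * 2"
      using K by (simp only: norm_mult) (intro mult_mono, auto)
  qed
  also have "integral {1/2..b} (\<lambda>s. K * exp (- pi * s) * 2) =
      (- 2 * K / pi) * exp (- pi * b) - (- 2 * K / pi) * exp (- pi * (1/2))"
  proof (rule integral_unique[OF fundamental_theorem_of_calculus[OF b]])
    fix s
    have "((\<lambda>s. (- 2 * K / pi) * exp (- pi * s)) has_real_derivative K * exp (- pi * s) * 2) (at s within {1/2..b})"
      by (auto intro!: derivative_eq_intros simp: field_simps)
    then show "((\<lambda>s. (- 2 * K / pi) * exp (- pi * s)) has_vector_derivative K * exp (- pi * s) * 2) (at s within {1/2..b})"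
      by (simp only: has_real_derivative_iff_has_vector_derivative)
  qed
  also have "\<dots> \<le> 2 * K * (exp (- pi * (1/2)) / pi)"
    using K by simp
  also have "\<dots> \<le> 2 * K * 1"
  proof (intro mult_left_mono)
    have "exp (- pi * (1/2)) \<le> 1" by simp
    also have "\<dots> \<le> pi" using pi_gt3 by simp
    finally show "exp (- pi * (1/2)) / pi \<le> 1" by simp
  qed (use K in auto)
  finally show ?thesis by (simp add: K_def)
qed

section \<open>Replacing the rational power by an exponential\<close>

lemma norm_pade_exp_le:
  fixes x :: complex
  assumes "norm x \<le> 1" "Re x \<ge> 0"
  shows "norm ((1 - x) / (1 + x) - exp (- 2 * x)) \<le> (2 + 4 * exp 2) * norm x ^ 3"
proof -
  have nz: "1 + x \<noteq> 0"
    using assms(2) by (auto simp: complex_eq_iff)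
  have ge1: "norm (1 + x) \<ge> 1"
    using complex_Re_le_cmod[of "1 + x"] assms(2) by simp
  \<comment> \<open>The quotient is the [1/1] Pade approximant of exp (- 2 x): both functions begin
    with 1 - 2 x + 2 x^2, so the errors are cubic.\<close>
  have "(1 - x) / (1 + x) - (1 - 2 * x + 2 * x\<^sup>2) = - 2 * x ^ 3 / (1 + x)"
    using nz by (simp add: field_simps power2_eq_square power3_eq_cube)
  also have "norm \<dots> = 2 * norm x ^ 3 / norm (1 + x)"
    by (simp add: norm_divide norm_mult norm_power)
  also have "\<dots> \<le> 2 * norm x ^ 3 / 1"
    using ge1 by (intro divide_left_mono) auto
  finally have 1: "norm ((1 - x) / (1 + x) - (1 - 2 * x + 2 * x\<^sup>2)) \<le> 2 * norm x ^ 3" by simp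
  have "norm (exp (- 2 * x) - (\<Sum>k\<le>2. (- 2 * x) ^ k / fact k)) \<le>
      exp \<bar>Re (- 2 * x)\<bar> * norm (- 2 * x) ^ Suc 2 / fact 2"
    by (rule Taylor_exp)
  also have "(\<Sum>k\<le>2. (- 2 * x) ^ k / fact k) = 1 - 2 * x + 2 * x\<^sup>2"
    by (simp add: numeral_2_eq_2 power2_eq_square)
  also have "exp \<bar>Re (- 2 * x)\<bar> * norm (- 2 * x) ^ Suc 2 / fact 2 = 4 * exp (2 * Re x) * norm x ^ 3"
    using assms(2) by (simp add: norm_mult power_mult_distrib numeral_2_eq_2 numeral_3_eq_3)
  also have "\<dots> \<le> 4 * exp 2 * norm x ^ 3"
    using complex_Re_le_cmod[of x] assms by (intro mult_right_mono mult_left_mono) auto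
  finally have 2: "norm (exp (- 2 * x) - (1 - 2 * x + 2 * x\<^sup>2)) \<le> 4 * exp 2 * norm x ^ 3" .
  from norm_triangle_ineq4[of "(1 - x) / (1 + x) - (1 - 2 * x + 2 * x\<^sup>2)" "exp (- 2 * x) - (1 - 2 * x + 2 * x\<^sup>2)"]
  show ?thesis using 1 2 by (simp add: algebra_simps)
qed

text \<open>Rescaling by a brings both numbers into the unit disc, where the difference of powers is
  at most n times the difference. The exponentially small factor a^n is thereby kept.\<close>

lemma norm_power_diff_scaled:
  fixes A B :: complex
  assumes "norm A \<le> a" "norm B \<le> a" "a > 0"
  shows "norm (A ^ n - B ^ n) \<le> a ^ n * (real n * norm (A - B) / a)"
proof -
  have "norm ((A / of_real a) ^ n - (B / of_real a) ^ n) \<le> real n * norm (A / of_real a - B / of_real a)"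
    using assms by (intro norm_power_diff) (auto simp: norm_divide)
  also have "(A / of_real a) ^ n - (B / of_real a) ^ n = (A ^ n - B ^ n) / of_real (a ^ n)"
    by (simp add: power_divide diff_divide_distrib)
  also have "A / of_real a - B / of_real a = (A - B) / of_real a"
    by (simp add: diff_divide_distrib)
  finally show ?thesis
    using assms(3) unfolding norm_divide norm_of_real
    by (simp add: abs_of_pos pos_divide_le_eq mult.commute)
qed

text \<open>With u = s (1 - i) this is - exp (- n / u) * wave s; all complex phases combine into the
  single factor 1 + i.\<close>

definition bessel_phase :: "nat \<Rightarrow> real \<Rightarrow> complex" where
  "bessel_phase n s = exp (- ((1 + \<i>) * of_real (real n / (2 * s) + 2 * pi * s)))"

text \<open>Two replacements are made. Taking u^2 for u^2 - 1/4 in the denominator costs 1 / s^4.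
  Taking B^n for A^n costs n / s^3 by the cubic Pade error with x = 1 / (2 u), divided by u^2. Both
  A and B are bounded by a = exp (- 1 / stretch s), so the full exponential decay survives.\<close>

lemma ratio_deriv_wave_approx:
  assumes s: "s \<ge> 1/2" and n: "n \<ge> 1"
  defines "K \<equiv> (2 + 4 * exp 2 :: real)"
  shows "norm (ratio_deriv n (ray s) * wave s * (1 - \<i>) - (- (1 + \<i>) * of_real (real n / (2 * s\<^sup>2)) * bessel_phase n s))
    \<le> real n * exp (- (2 * pi * s) - real n / stretch s) * (1 / s ^ 4 + real n * K / s ^ 5)"
proof -
  have s0: "s > 0" using s by simp
  define u where "u = of_real s * (1 - \<i>)"
  define A where "A = ray s / (1 + ray s)"
  define B where "B = exp (- (1 / u))"
  define a where "a = exp (- (1 / stretch s))"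
  have u0: "u \<noteq> 0" using s0 by (simp add: u_def complex_eq_iff)
  have u2: "u\<^sup>2 = - 2 * \<i> * of_real (s\<^sup>2)"
    by (simp add: u_def complex_eq_iff power2_eq_square)
  have iu: "1 / u = (1 + \<i>) / of_real (2 * s)"
  proof -
    have "(1 + \<i>) * u = of_real (2 * s)"
      by (simp add: u_def complex_eq_iff algebra_simps)
    then show ?thesis
      using u0 s0 by (subst frac_eq_eq) (auto simp del: of_real_mult)
  qed
  have factor: "N * p / c * w * d - N / e * d * (q * w) = N * w * d * (p / c - q / e)"
    for N p c w d e q :: complex
    by (simp add: right_diff_distrib mult_ac)
  have Bn: "B ^ n = exp (- ((1 + \<i>) * of_real (real n / (2 * s))))"
    unfolding B_def exp_of_nat_mult[symmetric] iu by (simp add: field_simps)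
  have w: "wave s = - exp (- ((1 + \<i>) * of_real (2 * pi * s)))"
  proof -
    have "- (2 * pi * \<i> * ray s) = \<i> * of_real pi + - ((1 + \<i>) * of_real (2 * pi * s))"
      by (simp add: ray_def complex_eq_iff algebra_simps)
    then show ?thesis
      unfolding wave_def by (simp only: exp_add) simp
  qed
  have "bessel_phase n s = - (B ^ n * wave s)"
    unfolding bessel_phase_def w Bn by (simp add: exp_add[symmetric] algebra_simps)
  moreover have "(1 + \<i>) * of_real (real n / (2 * s\<^sup>2)) = of_nat n / u\<^sup>2 * (1 - \<i>)"
  proof -
    have "(1 + \<i>) * u\<^sup>2 = (1 - \<i>) * of_real (2 * s\<^sup>2)"
      unfolding u2 by (simp add: complex_eq_iff)
    then have "(1 + \<i>) / of_real (2 * s\<^sup>2) = (1 - \<i>) / u\<^sup>2"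
      using u0 s0 by (subst frac_eq_eq) (auto simp del: of_real_mult)
    moreover have "(1 + \<i>) * of_real (real n / (2 * s\<^sup>2)) = of_nat n * ((1 + \<i>) / of_real (2 * s\<^sup>2))"
      by simp
    ultimately show ?thesis by simp
  qed
  ultimately have "- (1 + \<i>) * of_real (real n / (2 * s\<^sup>2)) * bessel_phase n s = of_nat n / u\<^sup>2 * (1 - \<i>) * (B ^ n * wave s)"
    by (simp only: mult_minus_left mult_minus_right minus_minus)
  moreover have "ratio_deriv n (ray s) * wave s * (1 - \<i>) = of_nat n * A ^ n / (u\<^sup>2 - 1/4) * wave s * (1 - \<i>)"
    unfolding ratio_deriv_ray[OF s0 n] u2 ray_times A_def by simp
  ultimately have "ratio_deriv n (ray s) * wave s * (1 - \<i>) - (- (1 + \<i>) * of_real (real n / (2 * s\<^sup>2)) * bessel_phase n s)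
    = of_nat n * wave s * (1 - \<i>) * (A ^ n / (u\<^sup>2 - 1/4) - B ^ n / u\<^sup>2)"
    by (simp only: factor)
  also have "A ^ n / (u\<^sup>2 - 1/4) - B ^ n / u\<^sup>2 =
      A ^ n * (1 / (u\<^sup>2 - 1/4) - 1 / u\<^sup>2) + (A ^ n - B ^ n) / u\<^sup>2"
    by (simp add: algebra_simps diff_divide_distrib)
  finally have eq: "ratio_deriv n (ray s) * wave s * (1 - \<i>) - (- (1 + \<i>) * of_real (real n / (2 * s\<^sup>2)) * bessel_phase n s)
    = of_nat n * wave s * (1 - \<i>) * (A ^ n * (1 / (u\<^sup>2 - 1/4) - 1 / u\<^sup>2) + (A ^ n - B ^ n) / u\<^sup>2)" .
  have nu2: "norm (u\<^sup>2) = 2 * s\<^sup>2"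
    by (simp add: u2 norm_mult norm_power)
  have nu2': "norm (u\<^sup>2 - 1/4) \<ge> 2 * s\<^sup>2"
    using norm_ray_times_ge[of s] unfolding u2 ray_times .
  have u2nz: "u\<^sup>2 - 1/4 \<noteq> 0"
  proof
    assume "u\<^sup>2 - 1/4 = 0"
    with nu2' have "2 * s\<^sup>2 \<le> 0" by (simp only: norm_zero)
    with s0 show False by simp
  qed
  have "1 / (u\<^sup>2 - 1/4) - 1 / u\<^sup>2 = (1/4) / ((u\<^sup>2 - 1/4) * u\<^sup>2)"
    using u2nz u0 by (simp add: field_simps)
  also have "norm \<dots> = (1/4) / (norm (u\<^sup>2 - 1/4) * norm (u\<^sup>2))"
    by (simp add: norm_divide norm_mult)
  also have "\<dots> \<le> (1/4) / ((2 * s\<^sup>2) * (2 * s\<^sup>2))"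
    unfolding nu2 using nu2' s0 by (intro divide_left_mono mult_right_mono mult_pos_pos) (simp_all only: zero_less_norm_iff u2nz not_False_eq_True, auto)
  also have "\<dots> \<le> (1/2) / s ^ 4"
    using s0 by (simp add: power_numeral_reduce field_simps)
  finally have d1: "norm (1 / (u\<^sup>2 - 1/4) - 1 / u\<^sup>2) \<le> (1/2) / s ^ 4" .
  have na: "norm A \<le> a"
    unfolding A_def a_def by (rule norm_ray_ratio_le[OF s])
  have nb: "norm B \<le> a"
  proof -
    have "norm B = exp (- (1 / (2 * s)))"
      using s0 unfolding B_def iu by (simp add: Re_divide_of_real)
    also have "\<dots> \<le> a"
      unfolding a_def using stretch_bounds(1)[OF s] s0 by (simp add: frac_le)
    finally show ?thesis .
  qed
  have ab: "norm (A - B) \<le> K / (8 * s ^ 3)"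
  proof -
    define x where "x = 1 / (2 * u)"
    have "norm (1 - \<i>) = sqrt 2"
      by (simp add: cmod_def)
    then have "norm x = 1 / (2 * s * sqrt 2)"
      using s0 by (simp add: x_def norm_divide norm_mult u_def)
    also have "\<dots> \<le> 1 / (2 * s * 1)"
      using s0 by (intro divide_left_mono mult_left_mono) auto
    finally have nx: "norm x \<le> 1 / (2 * s)" by simp
    also have "\<dots> \<le> 1" using s by simp
    finally have nx1: "norm x \<le> 1" .
    have "2 * x = (1 + \<i>) / of_real (2 * s)"
      unfolding iu[symmetric] x_def by simp
    then have "2 * Re x = 1 / (2 * s)"
      by (metis Re_divide_of_real Re_complex_of_real complex_Re_numeral mult_2 plus_complex.sel(1) imaginary_unit.sel(1) one_complex.sel(1) add.right_neutral)
    moreover have "1 / (2 * s) \<ge> 0" using s0 by simp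
    ultimately have rx: "Re x \<ge> 0" by linarith
    have r1: "ray s = u - 1/2" "1 + ray s = u + 1/2"
      by (simp_all add: ray_def u_def)
    have "A = (1 - x) / (1 + x)"
    proof -
      have "1 - x = (u - 1/2) / u" "1 + x = (u + 1/2) / u"
        using u0 by (simp_all add: x_def field_simps)
      then show ?thesis unfolding A_def r1 using u0 by simp
    qed
    moreover have "B = exp (- 2 * x)"
      by (simp add: B_def x_def)
    ultimately have "norm (A - B) \<le> K * norm x ^ 3"
      unfolding K_def using norm_pade_exp_le[OF nx1 rx] by simp
    also have "\<dots> \<le> K * (1 / (2 * s)) ^ 3"
      using nx by (intro mult_left_mono power_mono) (auto simp: K_def intro: add_nonneg_nonneg)
    finally show ?thesis by (simp add: power_divide power_mult_distrib)
  qed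
  have an: "a ^ n = exp (- (real n / stretch s))"
    by (simp add: a_def flip: exp_of_nat_mult)
  have a4: "1 / a \<le> 4"
  proof -
    have "1 / a = exp (1 / stretch s)" by (simp add: a_def exp_minus field_simps)
    also have "\<dots> \<le> exp 1" using stretch_bounds(4)[OF s] by simp
    also have "\<dots> \<le> 4" using exp_le by simp
    finally show ?thesis .
  qed
  have a0: "a > 0" by (simp add: a_def)
  have K0: "K > 0" by (simp add: K_def add_pos_pos)
  have "norm ((A ^ n - B ^ n) / u\<^sup>2) \<le> (a ^ n * (real n * norm (A - B) * (1 / a))) / (2 * s\<^sup>2)"
    unfolding norm_divide nu2 using norm_power_diff_scaled[OF na nb a0, of n] by (intro divide_right_mono) auto
  also have "\<dots> \<le> (a ^ n * (real n * (K / (8 * s ^ 3)) * 4)) / (2 * s\<^sup>2)"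
    using a0 ab a4 K0 s0 by (intro divide_right_mono mult_left_mono mult_mono) auto
  also have "\<dots> = a ^ n * (real n * K / (4 * s ^ 5))"
    using s0 by (simp add: power_numeral_reduce)
  also have "\<dots> \<le> a ^ n * (real n * K / (2 * s ^ 5))"
    using a0 K0 s0 by (intro mult_left_mono divide_left_mono) auto
  finally have d2: "norm ((A ^ n - B ^ n) / u\<^sup>2) \<le> a ^ n * (real n * K / (2 * s ^ 5))" .
  have "norm (A ^ n) \<le> a ^ n"
    using na unfolding norm_power by (intro power_mono) auto
  with d1 have "norm (A ^ n * (1 / (u\<^sup>2 - 1/4) - 1 / u\<^sup>2)) \<le> a ^ n * ((1/2) / s ^ 4)"
    unfolding norm_mult using a0 by (intro mult_mono) auto
  with d2 have "norm (A ^ n * (1 / (u\<^sup>2 - 1/4) - 1 / u\<^sup>2) + (A ^ n - B ^ n) / u\<^sup>2) \<le>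
     a ^ n * ((1/2) / s ^ 4) + a ^ n * (real n * K / (2 * s ^ 5))"
    by (intro norm_triangle_le add_mono)
  also have "\<dots> = a ^ n * ((1 / s ^ 4 + real n * K / s ^ 5) / 2)"
    by (simp add: field_simps)
  finally have d3: "norm (A ^ n * (1 / (u\<^sup>2 - 1/4) - 1 / u\<^sup>2) + (A ^ n - B ^ n) / u\<^sup>2) \<le>
     a ^ n * ((1 / s ^ 4 + real n * K / s ^ 5) / 2)" .
  have "norm (1 - \<i>) \<le> 2"
    using norm_triangle_ineq4[of 1 \<i>] by simp
  then have "norm (of_nat n * wave s * (1 - \<i>)) \<le> real n * exp (- (2 * pi * s)) * 2"
    unfolding norm_mult norm_wave norm_of_nat by (intro mult_left_mono) auto
  with d3 have "norm (of_nat n * wave s * (1 - \<i>) * (A ^ n * (1 / (u\<^sup>2 - 1/4) - 1 / u\<^sup>2) + (A ^ n - B ^ n) / u\<^sup>2))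
     \<le> real n * exp (- (2 * pi * s)) * 2 * (a ^ n * ((1 / s ^ 4 + real n * K / s ^ 5) / 2))"
    unfolding norm_mult[of _ "_ + _"] by (intro mult_mono) auto
  also have "\<dots> = real n * (exp (- (2 * pi * s)) * a ^ n) * (1 / s ^ 4 + real n * K / s ^ 5)"
    by simp
  also have "exp (- (2 * pi * s)) * a ^ n = exp (- (2 * pi * s) - real n / stretch s)"
    unfolding an by (simp flip: exp_add)
  finally show ?thesis unfolding eq .
qed

text \<open>The errors of both saddle point approximations are dominated by a Cauchy density in the saddle variable, so that \<open>arctan\<close> bounds its integral
  uniformly in the end points.\<close>

lemma integral_cauchy_saddle_le:
  fixes f :: "real \<Rightarrow> complex" and x :: "real \<Rightarrow> real"
  assumes ab: "a \<le> b" and f: "f integrable_on {a..b}" and n: "n \<ge> 1" and C: "C \<ge> 0"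
    and x: "\<And>s. s \<in> {a..b} \<Longrightarrow> x s > 0"
    and x': "\<And>s. s \<in> {a..b} \<Longrightarrow> (x has_real_derivative x' s) (at s within {a..b})"
    and le: "\<And>s. s \<in> {a..b} \<Longrightarrow> norm (f s) \<le> C * (saddle' n (x s) * x' s / (1 + (saddle n (x s))\<^sup>2))"
  shows "norm (integral {a..b} f) \<le> C * pi"
proof -
  have hi: "((\<lambda>s. C * (saddle' n (x s) * x' s / (1 + (saddle n (x s))\<^sup>2))) has_integral
     C * arctan (saddle n (x b)) - C * arctan (saddle n (x a))) {a..b}"
  proof (rule fundamental_theorem_of_calculus[OF ab])
    fix s assume s: "s \<in> {a..b}"
    have "((\<lambda>s. saddle n (x s)) has_real_derivative saddle' n (x s) * x' s) (at s within {a..b})"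
      by (rule DERIV_chain2[OF saddle_deriv[OF x[OF s] n] x'[OF s]])
    then have "((\<lambda>s. C * arctan (saddle n (x s))) has_real_derivative
        C * (inverse (1 + (saddle n (x s))\<^sup>2) * (saddle' n (x s) * x' s))) (at s within {a..b})"
      by (intro DERIV_cmult DERIV_chain2[OF DERIV_arctan])
    then show "((\<lambda>s. C * arctan (saddle n (x s))) has_vector_derivative
        C * (saddle' n (x s) * x' s / (1 + (saddle n (x s))\<^sup>2))) (at s within {a..b})"
      by (simp add: has_real_derivative_iff_has_vector_derivative field_simps)
  qed
  have "norm (integral {a..b} f) \<le> integral {a..b} (\<lambda>s. C * (saddle' n (x s) * x' s / (1 + (saddle n (x s))\<^sup>2)))"
    using f hi le by (intro integral_norm_bound_integral) auto
  also have "\<dots> = C * (arctan (saddle n (x b)) - arctan (saddle n (x a)))"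
    using integral_unique[OF hi] by (simp add: right_diff_distrib)
  also have "\<dots> \<le> C * pi"
    using C arctan_ubound[of "saddle n (x b)"] arctan_lbound[of "saddle n (x a)"]
    by (intro mult_left_mono) linarith+
  finally show ?thesis .
qed

text \<open>The factors are 3^5 from 1 / s \<le> 3 / stretch s, the Pade constant, exp (pi / 2) from
  trading 2 pi s for pi * stretch s, and the constant of \<open>saddle_weight_le\<close>.\<close>

definition approx_const :: real where
  "approx_const = 243 * (2 + 4 * exp 2) * exp (pi / 2) * (24 * pi\<^sup>2 * 5 ^ 5)"

lemma approx_const_pos: "approx_const > 0"
  by (simp add: approx_const_def add_pos_pos)

text \<open>The error bound decays like exp (- n / stretch s), so the saddle variable is taken at
  \<open>stretch s\<close> instead of 2 s. This makes the exponent exactly quadratic again, at the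
  price of pi / (4 s) \<le> pi / 2.\<close>

lemma norm_integral_ray_approx_le:
  assumes n: "n \<ge> 1" and b: "b \<ge> 1/2"
  shows "norm (integral {1/2..b} (\<lambda>s. ratio_deriv n (ray s) * wave s * (1 - \<i>))
            - integral {1/2..b} (\<lambda>s. - (1 + \<i>) * of_real (real n / (2 * s\<^sup>2)) * bessel_phase n s))
          \<le> approx_const * pi * (exp (- 2 * lam n) / sqrt (lam n))"
proof -
  define K :: real where "K = 2 + 4 * exp 2"
  have K1: "K \<ge> 1" using exp_gt_zero[of "2::real"] unfolding K_def by linarith
  have "1 + ray s \<noteq> 0" if "s \<ge> 1/2" for s
    using that by (intro ray_nz) auto
  then have c1: "continuous_on {1/2..b} (\<lambda>s. ratio_deriv n (ray s) * wave s * (1 - \<i>))"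
    unfolding ratio_deriv_def wave_def by (auto simp: ray_def intro!: continuous_intros)
  have c2: "continuous_on {1/2..b} (\<lambda>s. - (1 + \<i>) * of_real (real n / (2 * s\<^sup>2)) * bessel_phase n s)"
    unfolding bessel_phase_def by (intro continuous_intros) auto
  have "norm (integral {1/2..b} (\<lambda>s. ratio_deriv n (ray s) * wave s * (1 - \<i>)
            - (- (1 + \<i>) * of_real (real n / (2 * s\<^sup>2)) * bessel_phase n s)))
      \<le> (approx_const * (exp (- 2 * lam n) / sqrt (lam n))) * pi"
  proof (rule integral_cauchy_saddle_le[OF b _ n, where x = stretch and x' = "\<lambda>s. 2 - 1 / (4 * s\<^sup>2)"])
    show "(\<lambda>s. ratio_deriv n (ray s) * wave s * (1 - \<i>) -
       (- (1 + \<i>) * of_real (real n / (2 * s\<^sup>2)) * bessel_phase n s)) integrable_on {1/2..b}"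
      by (intro integrable_continuous_real continuous_on_diff c1 c2)
    show "approx_const * (exp (- 2 * lam n) / sqrt (lam n)) \<ge> 0"
      using approx_const_pos lam_ge_1[OF n] by simp
    fix s assume "s \<in> {1/2..b}"
    then have s: "s \<ge> 1/2" by simp
    then have s0: "s > 0" by simp
    show X0: "stretch s > 0" using stretch_bounds(4)[OF s] by simp
    show "(stretch has_real_derivative 2 - 1 / (4 * s\<^sup>2)) (at s within {1/2..b})"
      unfolding stretch_def[abs_def] using s0
      by (auto intro!: derivative_eq_intros simp: power2_eq_square)
    have "1 / (4 * s\<^sup>2) \<le> 1"
      using power_mono[OF s, of 2] s0 by (simp add: power2_eq_square field_simps)
    then have x'1: "2 - 1 / (4 * s\<^sup>2) \<ge> 1" by simp
    have "1 / (2 * s) \<le> 1" using s by simp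
    then have "pi * (1 / (2 * s)) \<le> pi * 1" by (intro mult_left_mono) auto
    then have "- (2 * pi * s) - real n / stretch s \<le> pi / 2 - (real n / stretch s + pi * stretch s)"
      using s0 by (simp add: stretch_def algebra_simps)
    also have "\<dots> = pi / 2 + (- 2 * lam n + - (saddle n (stretch s))\<^sup>2)"
      unfolding saddle_square[OF X0] by simp
    finally have e: "exp (- (2 * pi * s) - real n / stretch s) \<le>
        exp (pi / 2) * (exp (- 2 * lam n) * exp (- (saddle n (stretch s))\<^sup>2))"
      unfolding exp_add[symmetric] by simp
    have i: "1 / s \<le> 3 / stretch s"
      using stretch_bounds(3)[OF s] s0 X0 by (simp add: divide_simps)
    have "(1 / s) ^ 4 \<le> (3 / stretch s) ^ 4" "(1 / s) ^ 5 \<le> (3 / stretch s) ^ 5"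
      using i s0 by (intro power_mono; simp)+
    then have i4: "1 / s ^ 4 \<le> 81 / stretch s ^ 4" and i5: "1 / s ^ 5 \<le> 243 / stretch s ^ 5"
      by (simp_all add: power_divide)
    have "1 / s ^ 4 \<le> 243 * K * (1 / stretch s ^ 4)"
      using i4 K1 X0 mult_right_mono[of 81 "243 * K" "1 / stretch s ^ 4"] by simp
    moreover have "real n * K / s ^ 5 \<le> 243 * K * (real n / stretch s ^ 5)"
      using mult_left_mono[OF i5, of "real n * K"] K1 by (simp add: mult_ac)
    ultimately have "1 / s ^ 4 + real n * K / s ^ 5 \<le> 243 * K * (1 / stretch s ^ 4 + real n / stretch s ^ 5)"
      by (simp add: distrib_left)
    then have "real n * (1 / s ^ 4 + real n * K / s ^ 5) \<le> real n * (243 * K * (1 / stretch s ^ 4 + real n / stretch s ^ 5))"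
      by (rule mult_left_mono) simp
    also have "\<dots> = 243 * K * (real n / stretch s ^ 4 + (real n)\<^sup>2 / stretch s ^ 5)"
      by (simp add: algebra_simps power2_eq_square)
    finally have p: "real n * (1 / s ^ 4 + real n * K / s ^ 5) \<le> 243 * K * (real n / stretch s ^ 4 + (real n)\<^sup>2 / stretch s ^ 5)" .
    have "norm (ratio_deriv n (ray s) * wave s * (1 - \<i>) - (- (1 + \<i>) * of_real (real n / (2 * s\<^sup>2)) * bessel_phase n s))
      \<le> real n * exp (- (2 * pi * s) - real n / stretch s) * (1 / s ^ 4 + real n * K / s ^ 5)"
      unfolding K_def by (rule ratio_deriv_wave_approx[OF s n])
    also have "\<dots> = exp (- (2 * pi * s) - real n / stretch s) * (real n * (1 / s ^ 4 + real n * K / s ^ 5))"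
      by simp
    also have "\<dots> \<le> (exp (pi / 2) * (exp (- 2 * lam n) * exp (- (saddle n (stretch s))\<^sup>2))) *
        (243 * K * (real n / stretch s ^ 4 + (real n)\<^sup>2 / stretch s ^ 5))"
      by (rule mult_mono[OF e p]) (use K1 s0 in auto)
    also have "\<dots> = 243 * K * exp (pi / 2) * exp (- 2 * lam n) *
        ((real n / stretch s ^ 4 + (real n)\<^sup>2 / stretch s ^ 5) * exp (- (saddle n (stretch s))\<^sup>2))"
      by (simp only: mult_ac)
    also have "\<dots> \<le> 243 * K * exp (pi / 2) * exp (- 2 * lam n) *
        (24 * pi\<^sup>2 * 5 ^ 5 / sqrt (lam n) * (saddle' n (stretch s) / (1 + (saddle n (stretch s))\<^sup>2)))"
      using K1 by (intro mult_left_mono saddle_weight_le X0 n) auto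
    also have "\<dots> = approx_const * (exp (- 2 * lam n) / sqrt (lam n)) *
        (saddle' n (stretch s) * 1 / (1 + (saddle n (stretch s))\<^sup>2))"
      by (simp add: approx_const_def K_def)
    \<comment> \<open>The derivative of \<open>stretch\<close> is at least 1 for s \<ge> 1/2, so the
      Jacobian can be inserted for free.\<close>
    also have "\<dots> \<le> approx_const * (exp (- 2 * lam n) / sqrt (lam n)) *
        (saddle' n (stretch s) * (2 - 1 / (4 * s\<^sup>2)) / (1 + (saddle n (stretch s))\<^sup>2))"
      using approx_const_pos lam_ge_1[OF n] x'1 saddle'_nonneg[OF X0, of n]
      by (intro mult_left_mono divide_right_mono) auto
    finally show "norm (ratio_deriv n (ray s) * wave s * (1 - \<i>) - (- (1 + \<i>) * of_real (real n / (2 * s\<^sup>2)) * bessel_phase n s))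
      \<le> approx_const * (exp (- 2 * lam n) / sqrt (lam n)) *
        (saddle' n (stretch s) * (2 - 1 / (4 * s\<^sup>2)) / (1 + (saddle n (stretch s))\<^sup>2))" .
  qed
  then show ?thesis
    by (subst (asm) integral_diff[OF integrable_continuous_real[OF c1] integrable_continuous_real[OF c2]])
       (simp only: mult_ac)
qed

section \<open>The complex Gaussian integral\<close>

lemma gaussian_integral_tendsto:
  "((\<lambda>b. integral {0..b} (\<lambda>x. exp (- x\<^sup>2))) \<longlongrightarrow> sqrt pi / 2) at_top"
proof -
  have bi: "integral\<^sup>L lborel (\<lambda>x. indicator {0..} x *\<^sub>R exp (- x\<^sup>2)) = sqrt pi / 2"
     "integrable lborel (\<lambda>x::real. indicator {0..} x *\<^sub>R exp (- x\<^sup>2))"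
    using gaussian_moment_0 by (auto simp: has_bochner_integral_iff)
  have "((\<lambda>b. LBINT x:{..b}. indicator {0..} x *\<^sub>R exp (- x\<^sup>2)) \<longlongrightarrow> sqrt pi / 2) at_top"
    using tendsto_integral_at_top[OF sets_lborel bi(2)] unfolding bi(1) by (simp add: set_lebesgue_integral_def)
  moreover have "(LBINT x:{..b}. indicator {0..} x *\<^sub>R exp (- x\<^sup>2)) = integral {0..b} (\<lambda>x. exp (- x\<^sup>2))" for b :: real
  proof -
    have "(LBINT x:{..b}. indicator {0..} x *\<^sub>R exp (- x\<^sup>2)) = (LBINT x:{0..b}. exp (- x\<^sup>2))"
      unfolding set_lebesgue_integral_def by (intro Bochner_Integration.integral_cong) (auto simp: indicator_def)
    also have "\<dots> = integral {0..b} (\<lambda>x. exp (- x\<^sup>2))"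
      by (intro set_borel_integral_eq_integral borel_integrable_atLeastAtMost') (auto intro!: continuous_intros)
    finally show ?thesis .
  qed
  ultimately show ?thesis by simp
qed

text \<open>W is sqrt pi / 2 times the error function. It is odd because W (- z) + W z has
  derivative zero and vanishes at 0.\<close>

lemma complex_gaussian_primitive:
  obtains W :: "complex \<Rightarrow> complex" where
    "\<And>z. (W has_field_derivative exp (- z\<^sup>2)) (at z)" "\<And>z. W (- z) = - W z"
    "((\<lambda>x. W (of_real x)) \<longlongrightarrow> of_real (sqrt pi / 2)) at_top"
proof -
  have hol: "(\<lambda>z::complex. exp (- z\<^sup>2)) holomorphic_on UNIV"
    by (intro holomorphic_intros)
  obtain V :: "complex \<Rightarrow> complex"
    where "\<And>z. z \<in> UNIV \<Longrightarrow> (V has_field_derivative exp (- z\<^sup>2)) (at z within UNIV)"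
    by (rule holomorphic_convex_primitive'[OF convex_UNIV open_UNIV hol]) (rule that)
  then have V: "(V has_field_derivative exp (- z\<^sup>2)) (at z)" for z by simp
  define W where "W z = V z - V 0" for z
  have W: "(W has_field_derivative exp (- z\<^sup>2)) (at z)" for z
    unfolding W_def[abs_def] using DERIV_diff[OF V DERIV_const] by simp
  have "((\<lambda>z. W (- z) + W z) has_field_derivative 0) (at z)" for z
    using DERIV_add[OF DERIV_chain2[OF W DERIV_minus[OF DERIV_ident], of z] W[of z]] by simp
  then have "\<exists>k. \<forall>z\<in>UNIV. W (- z) + W z = k"
    by (intro has_field_derivative_zero_constant convex_UNIV) auto
  then have const: "W (- z) + W z = W (- 0) + W 0" for z
    by (metis UNIV_I)
  have odd: "W (- z) = - W z" for z
    using const[of z] unfolding W_def by (simp add: algebra_simps eq_diff_eq)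
  have W_real: "W (of_real b) = of_real (integral {0..b} (\<lambda>x. exp (- x\<^sup>2)))" if "b \<ge> 0" for b :: real
  proof -
    have "((\<lambda>x. exp (- (complex_of_real x)\<^sup>2)) has_integral W (of_real b) - W (of_real 0)) {0..b}"
    proof (rule fundamental_theorem_of_calculus[OF that])
      fix x :: real
      show "((\<lambda>x. W (of_real x)) has_vector_derivative exp (- (complex_of_real x)\<^sup>2)) (at x within {0..b})"
        using has_vector_derivative_real_field[OF W] by (rule has_vector_derivative_at_within)
    qed
    then have "((\<lambda>x. complex_of_real (exp (- x\<^sup>2))) has_integral W (of_real b)) {0..b}"
      by (simp add: W_def exp_of_real[symmetric])
    moreover have "((\<lambda>x. complex_of_real (exp (- x\<^sup>2))) has_integral of_real (integral {0..b} (\<lambda>x. exp (- x\<^sup>2)))) {0..b}"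
      by (intro has_integral_of_real integrable_integral integrable_continuous_real continuous_intros)
    ultimately show ?thesis by (rule has_integral_unique)
  qed
  have "eventually (\<lambda>b. of_real (integral {0..b} (\<lambda>x. exp (- x\<^sup>2))) = W (of_real b)) at_top"
    using eventually_ge_at_top[of 0] by (rule eventually_mono) (simp add: W_real)
  then have "((\<lambda>x. W (of_real x)) \<longlongrightarrow> of_real (sqrt pi / 2)) at_top"
    using tendsto_of_real[OF gaussian_integral_tendsto] by (rule Lim_transform_eventually[rotated])
  with W odd show ?thesis using that by blast
qed

text \<open>The vertical segment joining the ray of direction \<open>c\<close> to the real axis contributes a vanishing amount.\<close>

lemma tendsto_gaussian_primitive_ray:
  fixes c :: complex
  assumes W: "\<And>z. (W has_field_derivative exp (- z\<^sup>2)) (at z)"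
    and lim: "((\<lambda>x. W (of_real x)) \<longlongrightarrow> l) at_top"
    and c: "\<bar>Im c\<bar> < Re c"
  shows "((\<lambda>x. W (of_real x * c)) \<longlongrightarrow> l) at_top"
proof -
  define d where "d = (Re c)\<^sup>2 - (Im c)\<^sup>2"
  have "\<bar>Im c\<bar>\<^sup>2 < (Re c)\<^sup>2" using c by (intro power_strict_mono) auto
  then have d: "d > 0" by (simp add: d_def)
  have Rc: "Re c > 0" using c by linarith
  have bound: "norm (W (of_real x * c) - W (of_real (x * Re c))) \<le> exp (- (d * x\<^sup>2)) * (\<bar>Im c\<bar> * x)" if x: "x \<ge> 0" for x
  proof -
    have "norm (W (of_real x * c) - W (of_real (x * Re c))) \<le>
        exp (- (d * x\<^sup>2)) * norm (of_real x * c - of_real (x * Re c))"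
    proof (rule field_differentiable_bound[OF convex_closed_segment])
      fix z assume z: "z \<in> closed_segment (of_real (x * Re c)) (of_real x * c)"
      then obtain u where u: "0 \<le> u" "u \<le> 1" "z = (1 - u) *\<^sub>R of_real (x * Re c) + u *\<^sub>R (of_real x * c)"
        by (auto simp: closed_segment_def)
      show "(W has_field_derivative exp (- z\<^sup>2)) (at z within closed_segment (of_real (x * Re c)) (of_real x * c))"
        by (rule has_field_derivative_at_within[OF W])
      have "Re z = x * Re c" "Im z = u * (x * Im c)"
        by (simp_all add: u(3) algebra_simps)
      then have "Re (z\<^sup>2) = x\<^sup>2 * (Re c)\<^sup>2 - u\<^sup>2 * (x\<^sup>2 * (Im c)\<^sup>2)"
        by (simp add: Re_power2 power_mult_distrib)
      moreover have "u\<^sup>2 * (x\<^sup>2 * (Im c)\<^sup>2) \<le> 1 * (x\<^sup>2 * (Im c)\<^sup>2)"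
        using u by (intro mult_right_mono power_le_one) auto
      ultimately have "d * x\<^sup>2 \<le> Re (z\<^sup>2)"
        by (simp add: d_def algebra_simps)
      then show "norm (exp (- z\<^sup>2)) \<le> exp (- (d * x\<^sup>2))" by simp
    qed auto
    also have "of_real x * c - of_real (x * Re c) = of_real (x * Im c) * \<i>"
      by (simp add: complex_eq_iff)
    also have "norm \<dots> = \<bar>Im c\<bar> * x"
      using x by (simp add: norm_mult abs_mult)
    finally show ?thesis .
  qed
  have "((\<lambda>x. exp (- (d * x\<^sup>2)) * (\<bar>Im c\<bar> * x)) \<longlongrightarrow> 0) at_top"
    using d by real_asymp
  then have "((\<lambda>x. W (of_real x * c) - W (of_real (x * Re c))) \<longlongrightarrow> 0) at_top"
  proof (rule Lim_null_comparison[rotated])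
    show "\<forall>\<^sub>F x in at_top. norm (W (of_real x * c) - W (of_real (x * Re c))) \<le> exp (- (d * x\<^sup>2)) * (\<bar>Im c\<bar> * x)"
      using eventually_ge_at_top[of 0] by (rule eventually_mono) (rule bound)
  qed
  moreover have "filterlim (\<lambda>x. x * Re c) at_top at_top"
    using Rc by real_asymp
  then have "((\<lambda>x. W (of_real (x * Re c))) \<longlongrightarrow> l) at_top"
    by (rule filterlim_compose[OF lim])
  ultimately show ?thesis
    using tendsto_add by fastforce
qed

lemma integral_exp_minus_square_tail_le:
  fixes a b :: real
  assumes "1 \<le> a" "a \<le> b"
  shows "integral {a..b} (\<lambda>x. exp (- x\<^sup>2)) \<le> exp (- a\<^sup>2)"
proof -
  have hi: "((\<lambda>x. x * exp (- x\<^sup>2)) has_integral (- exp (- b\<^sup>2) / 2) - (- exp (- a\<^sup>2) / 2)) {a..b}"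
  proof (rule fundamental_theorem_of_calculus[OF assms(2)])
    fix x
    have "((\<lambda>x. - exp (- x\<^sup>2) / 2) has_real_derivative x * exp (- x\<^sup>2)) (at x within {a..b})"
      by (auto intro!: derivative_eq_intros)
    then show "((\<lambda>x. - exp (- x\<^sup>2) / 2) has_vector_derivative x * exp (- x\<^sup>2)) (at x within {a..b})"
      by (simp only: has_real_derivative_iff_has_vector_derivative)
  qed
  have "integral {a..b} (\<lambda>x. exp (- x\<^sup>2)) \<le> integral {a..b} (\<lambda>x. x * exp (- x\<^sup>2))"
    using assms(1) mult_right_mono[of 1 _ "exp (- _)"]
    by (intro integral_le integrable_continuous_real continuous_intros) auto
  also have "\<dots> \<le> exp (- a\<^sup>2)"
    unfolding integral_unique[OF hi] using exp_ge_zero[of "- a\<^sup>2"] exp_ge_zero[of "- b\<^sup>2"] by linarith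
  finally show ?thesis .
qed

text \<open>The principal square root in polar form; modulus and argument both enter the final
  asymptotics explicitly.\<close>

definition sqrt_one_plus_i :: complex where
  "sqrt_one_plus_i = of_real (2 powr (1/4)) * cis (pi / 8)"

lemma sqrt_one_plus_i_square: "sqrt_one_plus_i\<^sup>2 = 1 + \<i>"
proof -
  have "sqrt_one_plus_i\<^sup>2 = of_real ((2 powr (1/4))\<^sup>2) * cis (2 * (pi / 8))"
    by (simp add: sqrt_one_plus_i_def power_mult_distrib Complex.DeMoivre)
  also have "(2 powr (1/4))\<^sup>2 = sqrt (2::real)"
    by (simp add: powr_realpow[symmetric] powr_powr powr_half_sqrt[symmetric])
  also have "of_real (sqrt 2) * cis (2 * (pi / 8)) = 1 + \<i>"
    by (simp add: complex_eq_iff cos_45 sin_45)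
  finally show ?thesis .
qed

text \<open>The direction lies in the open sector |arg z| < pi / 4, where exp (- z^2)
  decays.\<close>

lemma sqrt_one_plus_i_Im_less_Re: "\<bar>Im sqrt_one_plus_i\<bar> < Re sqrt_one_plus_i"
proof -
  have "0 < sin (pi / 8)"
    by (rule sin_gt_zero) auto
  moreover have "sin (pi / 8) < sin (pi / 2 - pi / 8)"
    by (rule sin_monotone_2pi) auto
  then have "sin (pi / 8) < cos (pi / 8)"
    by (simp add: cos_sin_eq)
  ultimately show ?thesis
    by (simp add: sqrt_one_plus_i_def abs_mult)
qed

text \<open>P x is W (x c) / c for c^2 = 1 + i, hence odd with limits plus and minus sqrt pi / (2
  c). A rate is given at the negative end because the integral over s starts at the fixed point 1/2,
  while its upper end tends to infinity.\<close>

lemma oblique_gaussian_primitive: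
  obtains P :: "real \<Rightarrow> complex" where
    "\<And>x. (P has_vector_derivative exp (- ((1 + \<i>) * of_real (x\<^sup>2)))) (at x)"
    "(P \<longlongrightarrow> of_real (sqrt pi) / (2 * sqrt_one_plus_i)) at_top"
    "\<And>x. x \<ge> 1 \<Longrightarrow> norm (P (- x) + of_real (sqrt pi) / (2 * sqrt_one_plus_i)) \<le> exp (- x\<^sup>2)"
proof -
  obtain W :: "complex \<Rightarrow> complex" where W: "\<And>z. (W has_field_derivative exp (- z\<^sup>2)) (at z)" "\<And>z. W (- z) = - W z"
    "((\<lambda>x. W (of_real x)) \<longlongrightarrow> of_real (sqrt pi / 2)) at_top"
    by (rule complex_gaussian_primitive) (rule that)
  define P where "P x = W (of_real x * sqrt_one_plus_i) / sqrt_one_plus_i" for x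
  have nz: "sqrt_one_plus_i \<noteq> 0" by (simp add: sqrt_one_plus_i_def)
  have deriv: "(P has_vector_derivative exp (- ((1 + \<i>) * of_real (x\<^sup>2)))) (at x)" for x
  proof -
    have "((\<lambda>x. of_real x * sqrt_one_plus_i) has_vector_derivative sqrt_one_plus_i) (at x)"
      by (auto intro!: derivative_eq_intros)
    from field_vector_diff_chain_at[OF this W(1)]
    have "((\<lambda>x. W (of_real x * sqrt_one_plus_i)) has_vector_derivative sqrt_one_plus_i * exp (- (of_real x * sqrt_one_plus_i)\<^sup>2)) (at x)"
      by (simp add: o_def)
    from has_vector_derivative_divide[OF this, of sqrt_one_plus_i] show ?thesis
      using nz by (simp add: P_def[abs_def] power_mult_distrib sqrt_one_plus_i_square mult.commute)
  qed
  have lim: "(P \<longlongrightarrow> of_real (sqrt pi) / (2 * sqrt_one_plus_i)) at_top"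
    using tendsto_divide[OF tendsto_gaussian_primitive_ray[OF W(1,3) sqrt_one_plus_i_Im_less_Re] tendsto_const nz]
    by (simp add: P_def[abs_def])
  have "norm (P (- x) + of_real (sqrt pi) / (2 * sqrt_one_plus_i)) \<le> exp (- x\<^sup>2)" if x: "x \<ge> 1" for x
  proof -
    have odd: "P (- x) = - P x" by (simp add: P_def W(2))
    have le: "norm (P b - P x) \<le> exp (- x\<^sup>2)" if b: "b \<ge> x" for b
    proof -
      have hi: "((\<lambda>x. exp (- ((1 + \<i>) * of_real (x\<^sup>2)))) has_integral P b - P x) {x..b}"
        by (rule fundamental_theorem_of_calculus[OF b]) (rule has_vector_derivative_at_within[OF deriv])
      then have "norm (P b - P x) \<le> integral {x..b} (\<lambda>x. exp (- x\<^sup>2))"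
        unfolding integral_unique[OF hi, symmetric]
        by (intro integral_norm_bound_integral has_integral_integrable[OF hi] integrable_continuous_real continuous_intros)
           simp
      also have "\<dots> \<le> exp (- x\<^sup>2)"
        by (rule integral_exp_minus_square_tail_le[OF x b])
      finally show ?thesis .
    qed
    have "norm (of_real (sqrt pi) / (2 * sqrt_one_plus_i) - P x) \<le> exp (- x\<^sup>2)"
      by (rule tendsto_upperbound[OF tendsto_norm[OF tendsto_diff[OF lim tendsto_const]]
            eventually_mono[OF eventually_ge_at_top[of x] le]]) simp_all
    then show ?thesis by (simp add: odd)
  qed
  with deriv lim show ?thesis using that by blast
qed

section \<open>The saddle point contribution\<close>

lemma bessel_phase_saddle:
  assumes "s > 0"
  shows "bessel_phase n s = exp (- ((1 + \<i>) * of_real (2 * lam n))) * exp (- ((1 + \<i>) * of_real ((saddle n (2 * s))\<^sup>2)))"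
proof -
  have "real n / (2 * s) + 2 * pi * s = 2 * lam n + (saddle n (2 * s))\<^sup>2"
    using saddle_square[of "2 * s" n] assms by simp
  then show ?thesis
    unfolding bessel_phase_def by (simp add: exp_add[symmetric] algebra_simps)
qed

lemma norm_exp_one_plus_i: "norm (exp (- ((1 + \<i>) * of_real y))) = exp (- y)"
  by simp

lemma bessel_phase_deriv:
  assumes "s > 0"
  shows "(bessel_phase n has_vector_derivative
           (1 + \<i>) * of_real (real n / (2 * s\<^sup>2) - 2 * pi) * bessel_phase n s) (at s)"
proof -
  have "((\<lambda>s. real n / (2 * s) + 2 * pi * s) has_real_derivative - (real n / (2 * s\<^sup>2) - 2 * pi)) (at s)"
    using assms by (auto intro!: derivative_eq_intros simp: power2_eq_square field_simps)
  then have "((\<lambda>s. complex_of_real (real n / (2 * s) + 2 * pi * s)) has_vector_derivative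
      of_real (- (real n / (2 * s\<^sup>2) - 2 * pi))) (at s)"
    by (intro has_vector_derivative_of_real) (simp add: has_real_derivative_iff_has_vector_derivative)
  then have "((\<lambda>s. - ((1 + \<i>) * complex_of_real (real n / (2 * s) + 2 * pi * s))) has_vector_derivative
      - ((1 + \<i>) * of_real (- (real n / (2 * s\<^sup>2) - 2 * pi)))) (at s)"
    by (intro has_vector_derivative_minus has_vector_derivative_mult_right)
  from field_vector_diff_chain_at[OF this DERIV_exp]
  have "(bessel_phase n has_vector_derivative
      - ((1 + \<i>) * of_real (- (real n / (2 * s\<^sup>2) - 2 * pi))) * bessel_phase n s) (at s)"
    by (simp only: bessel_phase_def[abs_def] o_def)
  also have "- ((1 + \<i>) * of_real (- (real n / (2 * s\<^sup>2) - 2 * pi))) =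
      (1 + \<i>) * complex_of_real (real n / (2 * s\<^sup>2) - 2 * pi)"
    by (simp only: of_real_minus mult_minus_right minus_minus)
  finally show ?thesis .
qed

text \<open>The density \<open>n / (2 s\<^sup>2)\<close> is half of \<open>n / (2 s\<^sup>2) - 2 pi\<close>, which the exponential integrates exactly, plus
  \<open>n / (4 s\<^sup>2) + pi\<close>; the latter is compared with the density \<open>2 * saddle' n (2 * s)\<close> of the Gaussian.\<close>

lemma saddle_remainder_bounds:
  assumes s: "s > 0" and n: "n \<ge> 1"
  defines "\<rho> \<equiv> real n / (4 * s\<^sup>2) + pi - 2 * sqrt (lam n) * saddle' n (2 * s)"
  shows "0 \<le> \<rho>" "\<rho> \<le> (saddle n (2 * s))\<^sup>2 * saddle' n (2 * s) / sqrt (lam n)"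
proof -
  define S where "S = sqrt (pi * (2 * s)) + sqrt (real n / (2 * s))"
  define L where "L = sqrt (lam n)"
  define w where "w = saddle n (2 * s)"
  have L: "L > 0" "L\<^sup>2 = lam n"
    using lam_ge_1[OF n] by (simp_all add: L_def)
  have w2: "w\<^sup>2 = real n / (2 * s) + pi * (2 * s) - 2 * L\<^sup>2"
    unfolding w_def L(2) by (rule saddle_square) (use s in simp)
  have S2: "S\<^sup>2 = w\<^sup>2 + 4 * L\<^sup>2"
    unfolding w2 L(2) S_def using sqrt_mult_lam[of "2 * s" n] s by (simp add: power2_sum)
  have SL: "2 * L \<le> S"
    unfolding S_def L_def by (rule saddle_sum_ge) (use s in simp)
  have s': "saddle' n (2 * s) = S / (4 * s)"
    by (simp add: saddle'_def S_def)
  have "\<rho> = ((real n / (2 * s) + pi * (2 * s)) - L * S) / (2 * s)"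
    unfolding \<rho>_def s' L_def[symmetric] using s by (simp add: field_simps power2_eq_square)
  also have "real n / (2 * s) + pi * (2 * s) = w\<^sup>2 + 2 * L\<^sup>2"
    unfolding w2 by simp
  finally have \<rho>: "\<rho> = (w\<^sup>2 + 2 * L\<^sup>2 - L * S) / (2 * s)" .
  have "0 \<le> (L - S / 2)\<^sup>2" by simp
  also have "\<dots> = L\<^sup>2 + S\<^sup>2 / 4 - L * S"
    by (simp add: power2_diff power_divide)
  also have "\<dots> \<le> w\<^sup>2 + 2 * L\<^sup>2 - L * S"
    unfolding S2 by simp
  finally show "0 \<le> \<rho>" unfolding \<rho> using s by simp
  have "L * (2 * L) \<le> L * S" using SL L(1) by (intro mult_left_mono) auto
  then have "w\<^sup>2 + 2 * L\<^sup>2 - L * S \<le> w\<^sup>2 * 1" by (simp add: power2_eq_square)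
  also have "\<dots> \<le> w\<^sup>2 * (S / (2 * L))"
    using SL L(1) by (intro mult_left_mono) auto
  finally have "\<rho> \<le> (w\<^sup>2 * (S / (2 * L))) / (2 * s)"
    unfolding \<rho> using s by (intro divide_right_mono) auto
  also have "\<dots> = w\<^sup>2 * saddle' n (2 * s) / L"
    unfolding s' using s L(1) by (simp add: field_simps)
  finally show "\<rho> \<le> (saddle n (2 * s))\<^sup>2 * saddle' n (2 * s) / sqrt (lam n)"
    by (simp add: w_def L_def)
qed

lemma mult_exp_minus_le:
  fixes y :: real
  assumes "y \<ge> 0"
  shows "y * exp (- y) \<le> 2 / (1 + y)"
proof -
  have "1 + y + y\<^sup>2 / 2 \<le> exp y"
    by (rule exp_lower_Taylor_quadratic[OF assms])
  then have "y * (1 + y) \<le> 2 * exp y"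
    using assms by (simp add: power2_eq_square algebra_simps)
  then show ?thesis
    using assms by (simp add: exp_minus divide_simps)
qed

text \<open>Two parts of the density integrate exactly, one to P and one to
  \<open>bessel_phase\<close>. The factor sqrt (lam n) in front of P makes the remaining density
  vanish at the saddle point; it is of order w^2 there, and w^2 exp (- w^2) is again below a
  multiple of the Cauchy weight.\<close>

lemma bessel_integral_approx:
  assumes n: "n \<ge> 1" and b: "b \<ge> 1/2"
    and P: "\<And>x. (P has_vector_derivative exp (- ((1 + \<i>) * of_real (x\<^sup>2)))) (at x)"
  shows "norm (integral {1/2..b} (\<lambda>s. of_real (real n / (2 * s\<^sup>2)) * bessel_phase n s)
           - of_real (sqrt (lam n)) * exp (- ((1 + \<i>) * of_real (2 * lam n))) * (P (saddle n (2 * b)) - P (saddle n 1))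
           - (bessel_phase n b - bessel_phase n (1/2)) / (2 * (1 + \<i>)))
         \<le> pi * (exp (- 2 * lam n) / sqrt (lam n))"
proof -
  define E where "E = exp (- ((1 + \<i>) * of_real (2 * lam n)))"
  define g where "g s = exp (- ((1 + \<i>) * of_real ((saddle n (2 * s))\<^sup>2)))" for s
  have nz: "1 + \<i> \<noteq> 0" by (simp add: complex_eq_iff)
  have "continuous_on {1/2..b} (\<lambda>s. of_real (real n / (2 * s\<^sup>2)) * bessel_phase n s)"
    unfolding bessel_phase_def by (intro continuous_intros) auto
  then have h1: "((\<lambda>s. of_real (real n / (2 * s\<^sup>2)) * bessel_phase n s) has_integral
       integral {1/2..b} (\<lambda>s. of_real (real n / (2 * s\<^sup>2)) * bessel_phase n s)) {1/2..b}"
    by (intro integrable_integral integrable_continuous_real)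
  have h2: "((\<lambda>s. of_real (saddle' n (2 * s) * 2) * g s) has_integral P (saddle n (2 * b)) - P (saddle n (2 * (1/2)))) {1/2..b}"
  proof (rule fundamental_theorem_of_calculus[OF b])
    fix s assume "s \<in> {1/2..b}"
    then have s: "2 * s > 0" by simp
    have "((\<lambda>s. saddle n (2 * s)) has_real_derivative saddle' n (2 * s) * 2) (at s)"
      by (rule DERIV_chain2[where f = "saddle n" and g = "\<lambda>s. 2 * s", OF saddle_deriv[OF s n]]) (auto intro!: derivative_eq_intros)
    then have "((\<lambda>s. saddle n (2 * s)) has_vector_derivative saddle' n (2 * s) * 2) (at s)"
      by (simp only: has_real_derivative_iff_has_vector_derivative)
    from vector_diff_chain_at[OF this P]
    have "((\<lambda>s. P (saddle n (2 * s))) has_vector_derivative (saddle' n (2 * s) * 2) *\<^sub>R g s) (at s)"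
      by (simp add: o_def g_def)
    then show "((\<lambda>s. P (saddle n (2 * s))) has_vector_derivative of_real (saddle' n (2 * s) * 2) * g s) (at s within {1/2..b})"
      unfolding scaleR_conv_of_real by (rule has_vector_derivative_at_within)
  qed
  have h3: "((\<lambda>s. (1 + \<i>) * of_real (real n / (2 * s\<^sup>2) - 2 * pi) * bessel_phase n s) has_integral
      bessel_phase n b - bessel_phase n (1/2)) {1/2..b}"
    by (rule fundamental_theorem_of_calculus[OF b], rule has_vector_derivative_at_within[OF bessel_phase_deriv]) simp
  define f where "f s = of_real (real n / (2 * s\<^sup>2)) * bessel_phase n s
      - of_real (sqrt (lam n)) * E * (of_real (saddle' n (2 * s) * 2) * g s)
      - (1 + \<i>) * of_real (real n / (2 * s\<^sup>2) - 2 * pi) * bessel_phase n s / (2 * (1 + \<i>))" for s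
  have hf: "(f has_integral (integral {1/2..b} (\<lambda>s. of_real (real n / (2 * s\<^sup>2)) * bessel_phase n s)
           - of_real (sqrt (lam n)) * E * (P (saddle n (2 * b)) - P (saddle n (2 * (1/2))))
           - (bessel_phase n b - bessel_phase n (1/2)) / (2 * (1 + \<i>)))) {1/2..b}"
    unfolding f_def[abs_def]
    by (intro has_integral_diff h1 has_integral_mult_right h2 has_integral_divide h3)
  have "norm (integral {1/2..b} f) \<le> (exp (- 2 * lam n) / sqrt (lam n)) * pi"
  proof (rule integral_cauchy_saddle_le[OF b has_integral_integrable[OF hf] n, where x = "\<lambda>s. 2 * s" and x' = "\<lambda>s. 2"])
    show "exp (- 2 * lam n) / sqrt (lam n) \<ge> 0"
      using lam_ge_1[OF n] by simp
    fix s assume "s \<in> {1/2..b}"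
    then have s: "s > 0" by simp
    show "2 * s > 0" using s by simp
    show "((\<lambda>s. 2 * s) has_real_derivative 2) (at s within {1/2..b})"
      by (auto intro!: derivative_eq_intros)
    define \<rho> where "\<rho> = real n / (4 * s\<^sup>2) + pi - 2 * sqrt (lam n) * saddle' n (2 * s)"
    define w where "w = saddle n (2 * s)"
    have Eg: "bessel_phase n s = E * g s"
      unfolding E_def g_def by (rule bessel_phase_saddle[OF s])
    define c where "c = real n / (4 * s\<^sup>2)"
    have c: "real n / (2 * s\<^sup>2) = 2 * c" by (simp add: c_def)
    have cancel: "a * x * z / (2 * a) = (x / 2) * z" if "a \<noteq> 0" for a x z :: complex
      using that by simp
    have "of_real (2 * c - 2 * pi) / 2 = complex_of_real (c - pi)"
      by (simp add: field_simps)
    then have "f s = of_real (2 * c) * (E * g s) - of_real (sqrt (lam n)) * E * (of_real (saddle' n (2 * s) * 2) * g s)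
        - of_real (c - pi) * (E * g s)"
      unfolding f_def Eg c cancel[OF nz] by (simp only:)
    also have "\<dots> = of_real \<rho> * (E * g s)"
      unfolding \<rho>_def c_def[symmetric] by (simp add: algebra_simps)
    finally have "f s = of_real \<rho> * (E * g s)" .
    moreover have "0 \<le> \<rho>"
      unfolding \<rho>_def by (rule saddle_remainder_bounds(1)[OF s n])
    ultimately have "norm (f s) = \<rho> * (exp (- (2 * lam n)) * exp (- w\<^sup>2))"
      by (simp only: E_def g_def w_def norm_mult norm_of_real norm_exp_one_plus_i abs_of_nonneg)
    also have "\<dots> \<le> (w\<^sup>2 * saddle' n (2 * s) / sqrt (lam n)) * (exp (- (2 * lam n)) * exp (- w\<^sup>2))"
      using saddle_remainder_bounds(2)[OF s n] unfolding \<rho>_def w_def by (rule mult_right_mono) simp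
    also have "\<dots> = exp (- 2 * lam n) / sqrt (lam n) * saddle' n (2 * s) * (w\<^sup>2 * exp (- w\<^sup>2))"
      by simp
    also have "\<dots> \<le> exp (- 2 * lam n) / sqrt (lam n) * saddle' n (2 * s) * (2 / (1 + w\<^sup>2))"
      using saddle'_nonneg[of "2 * s" n] s lam_ge_1[OF n]
      by (intro mult_left_mono mult_exp_minus_le) auto
    finally show "norm (f s) \<le> exp (- 2 * lam n) / sqrt (lam n) * (saddle' n (2 * s) * 2 / (1 + (saddle n (2 * s))\<^sup>2))"
      by (simp add: w_def)
  qed
  then show ?thesis
    unfolding integral_unique[OF hf] E_def by (simp add: mult.commute)
qed

text \<open>The prefactor - (1 + i) of the model integrand times sqrt (lam n), the value of the
  exponential at the saddle point and the complete Gaussian integral sqrt pi / sqrt_one_plus_i. One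
  square root of 1 + i remains.\<close>

definition leading :: "nat \<Rightarrow> complex" where
  "leading n = - (of_real (sqrt pi * sqrt (lam n)) * sqrt_one_plus_i * exp (- ((1 + \<i>) * of_real (2 * lam n))))"

lemma saddle_one: "saddle n 1 = - (sqrt (real n) - sqrt pi)"
  by (simp add: saddle_def)

text \<open>Completing the Gaussian at the lower end s = 1/2 costs a factor exp (- (sqrt n - sqrt
  pi)^2). Everything that depends on the upper end goes into \<open>\<delta>\<close>, which vanishes
  as M grows.\<close>

lemma ray_integral_leading:
  assumes n: "n \<ge> 9"
  obtains \<delta> :: "nat \<Rightarrow> real" where "\<delta> \<longlonglongrightarrow> 0"
    "\<And>M. norm (integral {1/2..real M + 1} (\<lambda>s. - (1 + \<i>) * of_real (real n / (2 * s\<^sup>2)) * bessel_phase n s) - leading n)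
      \<le> 2 * (exp (- 2 * lam n) * ((sqrt (lam n) + 1) * exp (- (sqrt (real n) - sqrt pi)\<^sup>2) + pi / sqrt (lam n))) + \<delta> M"
proof -
  obtain P where P: "\<And>x. (P has_vector_derivative exp (- ((1 + \<i>) * of_real (x\<^sup>2)))) (at x)"
    "(P \<longlongrightarrow> of_real (sqrt pi) / (2 * sqrt_one_plus_i)) at_top"
    "\<And>x. x \<ge> 1 \<Longrightarrow> norm (P (- x) + of_real (sqrt pi) / (2 * sqrt_one_plus_i)) \<le> exp (- x\<^sup>2)"
    by (rule oblique_gaussian_primitive) (rule that)
  define l where "l = of_real (sqrt pi) / (2 * sqrt_one_plus_i)"
  define E where "E = exp (- ((1 + \<i>) * of_real (2 * lam n)))"
  define \<epsilon> where "\<epsilon> = exp (- (sqrt (real n) - sqrt pi)\<^sup>2)"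
  define \<delta> where "\<delta> M = 2 * (sqrt (lam n) * exp (- 2 * lam n) * norm (P (saddle n (2 * (real M + 1))) - l)
      + exp (- (2 * pi * (real M + 1))))" for M
  have n1: "n \<ge> 1" using n by simp
  have nE: "norm E = exp (- 2 * lam n)"
    unfolding E_def norm_exp_one_plus_i by simp
  have nz: "1 + \<i> \<noteq> 0" "sqrt_one_plus_i \<noteq> 0"
    using sqrt_one_plus_i_square by (auto simp: complex_eq_iff)
  \<comment> \<open>The bound n \<ge> 9 comes from here: sqrt n \<ge> 3 and sqrt pi \<le> 2 put the
    lower end of the saddle variable at or below -1, where the tail bound for P applies.\<close>
  have big: "sqrt (real n) - sqrt pi \<ge> 1"
  proof -
    have "sqrt 9 \<le> sqrt (real n)" using n by (intro real_sqrt_le_mono) simp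
    moreover have "sqrt pi \<le> sqrt 4" using pi_less_4 by (intro real_sqrt_le_mono) simp
    ultimately show ?thesis by simp
  qed
  have n2: "norm (1 + \<i>) \<le> 2"
    using norm_triangle_ineq[of 1 \<i>] by simp
  have n1i: "norm (1 / (2 * (1 + \<i>))) \<le> 1"
  proof -
    have "norm (1 + \<i>) \<ge> 1" using complex_Re_le_cmod[of "1 + \<i>"] by simp
    moreover have "norm (1 / (2 * (1 + \<i>))) = 1 / (2 * norm (1 + \<i>))"
      by (simp only: norm_divide norm_mult norm_one norm_numeral)
    moreover have "1 / (2 * a) \<le> 1" if "a \<ge> 1" for a :: real
      using that by (simp add: divide_le_eq)
    ultimately show ?thesis by (simp only:)
  qed
  have lead: "leading n = - (1 + \<i>) * (of_real (sqrt (lam n)) * E * (2 * l))"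
    unfolding leading_def l_def E_def sqrt_one_plus_i_square[symmetric] using nz
    by (simp add: power2_eq_square)
  have zb: "norm (bessel_phase n s) = exp (- (real n / (2 * s) + 2 * pi * s))" for s
    unfolding bessel_phase_def by (rule norm_exp_one_plus_i)
  have "real n / (2 * (1/2)) + 2 * pi * (1/2) = 2 * lam n + (sqrt (real n) - sqrt pi)\<^sup>2"
    by (simp add: power2_diff lam_def real_sqrt_mult)
  then have z0: "norm (bessel_phase n (1/2)) = exp (- 2 * lam n) * \<epsilon>"
    unfolding zb \<epsilon>_def by (simp add: exp_add[symmetric])
  have "norm (integral {1/2..real M + 1} (\<lambda>s. - (1 + \<i>) * of_real (real n / (2 * s\<^sup>2)) * bessel_phase n s) - leading n)
      \<le> 2 * (exp (- 2 * lam n) * ((sqrt (lam n) + 1) * \<epsilon> + pi / sqrt (lam n))) + \<delta> M" for M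
  proof -
    define b where "b = real M + 1"
    define I where "I = integral {1/2..b} (\<lambda>s. of_real (real n / (2 * s\<^sup>2)) * bessel_phase n s)"
    define D where "D = I - of_real (sqrt (lam n)) * E * (P (saddle n (2 * b)) - P (saddle n 1))
       - (bessel_phase n b - bessel_phase n (1/2)) / (2 * (1 + \<i>))"
    have D: "norm D \<le> pi * (exp (- 2 * lam n) / sqrt (lam n))"
      unfolding D_def I_def E_def by (rule bessel_integral_approx[OF n1 _ P(1)]) (simp add: b_def)
    have I: "integral {1/2..b} (\<lambda>s. - (1 + \<i>) * of_real (real n / (2 * s\<^sup>2)) * bessel_phase n s) = - (1 + \<i>) * I"
      unfolding I_def by (subst integral_mult_right[symmetric]) (simp add: mult.assoc)
    have "I - of_real (sqrt (lam n)) * E * (2 * l) =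
        D + of_real (sqrt (lam n)) * E * ((P (saddle n (2 * b)) - l) - (P (saddle n 1) + l))
          + (bessel_phase n b - bessel_phase n (1/2)) * (1 / (2 * (1 + \<i>)))"
      by (simp add: D_def algebra_simps)
    also have "norm \<dots> \<le> norm D + norm (of_real (sqrt (lam n)) * E * ((P (saddle n (2 * b)) - l) - (P (saddle n 1) + l)))
         + norm ((bessel_phase n b - bessel_phase n (1/2)) * (1 / (2 * (1 + \<i>))))"
      by (intro norm_triangle_le add_mono order_refl)
    also have "\<dots> \<le> pi * (exp (- 2 * lam n) / sqrt (lam n))
        + sqrt (lam n) * exp (- 2 * lam n) * (norm (P (saddle n (2 * b)) - l) + \<epsilon>)
        + (exp (- (2 * pi * b)) + exp (- 2 * lam n) * \<epsilon>)"
    proof (intro add_mono D)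
      have "norm (P (saddle n 1) + l) \<le> \<epsilon>"
        unfolding saddle_one l_def \<epsilon>_def by (rule P(3)[OF big])
      then have "norm ((P (saddle n (2 * b)) - l) - (P (saddle n 1) + l)) \<le> norm (P (saddle n (2 * b)) - l) + \<epsilon>"
        by (intro order_trans[OF norm_triangle_ineq4] add_left_mono)
      moreover have "norm (of_real (sqrt (lam n)) * E) = sqrt (lam n) * exp (- 2 * lam n)"
        using lam_ge_1[OF n1] by (simp add: norm_mult nE)
      ultimately show "norm (of_real (sqrt (lam n)) * E * ((P (saddle n (2 * b)) - l) - (P (saddle n 1) + l))) \<le>
          sqrt (lam n) * exp (- 2 * lam n) * (norm (P (saddle n (2 * b)) - l) + \<epsilon>)"
        using lam_ge_1[OF n1] unfolding norm_mult[of "_ * E"] by (simp add: mult_left_mono)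
      have "norm (bessel_phase n b) \<le> exp (- (2 * pi * b))"
        unfolding zb by (simp add: b_def)
      then have "norm (bessel_phase n b - bessel_phase n (1/2)) \<le> exp (- (2 * pi * b)) + exp (- 2 * lam n) * \<epsilon>"
        using norm_triangle_ineq4[of "bessel_phase n b" "bessel_phase n (1/2)"] z0 by linarith
      from mult_mono[OF this n1i] show "norm ((bessel_phase n b - bessel_phase n (1/2)) * (1 / (2 * (1 + \<i>)))) \<le>
          exp (- (2 * pi * b)) + exp (- 2 * lam n) * \<epsilon>"
        unfolding norm_mult[of "_ - _"] by (simp add: \<epsilon>_def)
    qed
    finally have "norm (I - of_real (sqrt (lam n)) * E * (2 * l)) \<le> pi * (exp (- 2 * lam n) / sqrt (lam n))
        + sqrt (lam n) * exp (- 2 * lam n) * (norm (P (saddle n (2 * b)) - l) + \<epsilon>)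
        + (exp (- (2 * pi * b)) + exp (- 2 * lam n) * \<epsilon>)" .
    moreover have "norm (- (1 + \<i>) * I - leading n) = norm (1 + \<i>) * norm (I - of_real (sqrt (lam n)) * E * (2 * l))"
      unfolding lead right_diff_distrib[symmetric] norm_mult norm_minus_cancel ..
    ultimately have "norm (- (1 + \<i>) * I - leading n) \<le> 2 * (pi * (exp (- 2 * lam n) / sqrt (lam n))
        + sqrt (lam n) * exp (- 2 * lam n) * (norm (P (saddle n (2 * b)) - l) + \<epsilon>)
        + (exp (- (2 * pi * b)) + exp (- 2 * lam n) * \<epsilon>))"
      using n2 by (simp only:) (intro mult_mono, auto)
    also have "\<dots> = 2 * (exp (- 2 * lam n) * ((sqrt (lam n) + 1) * \<epsilon> + pi / sqrt (lam n))) + \<delta> M"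
      by (simp add: \<delta>_def b_def algebra_simps)
    finally show ?thesis unfolding I[symmetric] b_def .
  qed
  moreover have "\<delta> \<longlonglongrightarrow> 0"
  proof -
    have "filterlim (\<lambda>M. saddle n (2 * (real M + 1))) at_top sequentially"
    proof -
      have "real n > 0" using n by simp
      then show ?thesis unfolding saddle_def by real_asymp
    qed
    from filterlim_compose[OF P(2) this]
    have "(\<lambda>M. norm (P (saddle n (2 * (real M + 1))) - l)) \<longlonglongrightarrow> norm (l - l)"
      unfolding l_def by (intro tendsto_intros)
    moreover have "(\<lambda>M. exp (- (2 * pi * (real M + 1)))) \<longlonglongrightarrow> 0"
      by real_asymp
    ultimately have "\<delta> \<longlonglongrightarrow> 2 * (sqrt (lam n) * exp (- 2 * lam n) * norm (l - l) + 0)"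
      unfolding \<delta>_def by (intro tendsto_mult tendsto_add tendsto_const)
    then show ?thesis by simp
  qed
  ultimately show ?thesis using that unfolding \<epsilon>_def by blast
qed

section \<open>The leading term in real form and the total error\<close>

lemma Im_leading:
  assumes "n \<ge> 1"
  shows "Im (leading n) = pi * ((2 * real n / pi) powr (1/4) * exp (- 2 * sqrt (pi * real n)) * cos (2 * sqrt (pi * real n) - 5 * pi / 8))"
proof -
  have "exp (- ((1 + \<i>) * of_real (2 * lam n))) = of_real (exp (- 2 * lam n)) * cis (- 2 * lam n)"
    by (simp add: exp_of_real[symmetric] cis_conv_exp exp_add[symmetric] algebra_simps)
  then have "leading n = - (of_real (sqrt pi * sqrt (lam n) * 2 powr (1/4) * exp (- 2 * lam n)) * (cis (pi / 8) * cis (- 2 * lam n)))"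
    by (simp add: leading_def sqrt_one_plus_i_def)
  \<comment> \<open>The argument pi / 8 of the square root meets - 2 lam n from the exponential, and
    the minus sign of \<open>leading\<close> reverses the sine.\<close>
  then have "Im (leading n) = sqrt pi * sqrt (lam n) * 2 powr (1/4) * exp (- 2 * lam n) * sin (2 * lam n - pi / 8)"
    by (simp add: cis_mult sin_diff algebra_simps)
  also have "sin (2 * lam n - pi / 8) = cos (2 * lam n - 5 * pi / 8)"
  proof -
    have "2 * lam n - 5 * pi / 8 = (2 * lam n - pi / 8) - pi / 2" by simp
    then show ?thesis by (simp only: cos_diff) simp
  qed
  also have "sqrt pi * sqrt (lam n) * 2 powr (1/4) = pi * (2 * real n / pi) powr (1/4)"
  proof -
    have 1: "sqrt (lam n) = pi powr (1/4) * real n powr (1/4)"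
      using assms by (simp add: lam_def powr_half_sqrt[symmetric] powr_powr powr_mult)
    have 2: "(2 * real n / pi) powr (1/4) = 2 powr (1/4) * real n powr (1/4) / pi powr (1/4)"
      using assms by (simp add: powr_divide powr_mult)
    have "sqrt pi * (pi powr (1/4) * pi powr (1/4)) = pi"
      by (simp add: powr_add[symmetric] powr_half_sqrt)
    then have "sqrt pi * pi powr (1/4) = pi / pi powr (1/4)"
      by (simp add: field_simps)
    then show ?thesis unfolding 1 2 by (simp add: field_simps)
  qed
  finally show ?thesis by (simp add: lam_def)
qed

text \<open>The four errors come from the segment to - i/2, the nonlinear part of the logarithm, the
  replacement of the rational power, and the Gaussian approximation. The linear term carries the
  factor r, so the comparison is with r * leading n, and r < 1 keeps all bounds independent of r.
  The imaginary part of the contour integral tends to - pi times the sawtooth integral, which is why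
  Im (leading n) is pi times the main term.\<close>

lemma newton_coeff_approx:
  assumes n: "n \<ge> 9"
  shows "\<bar>newton_coeff n - (2 * real n / pi) powr (1/4) * exp (- 2 * sqrt (pi * real n)) * cos (2 * sqrt (pi * real n) - 5 * pi / 8)\<bar>
    \<le> 2 * real n * (1/2) ^ n + 8 * exp (3 * pi / 4) * real n * exp (- 2 * sqrt (3 * pi * real n / 2))
      + approx_const * pi * (exp (- 2 * lam n) / sqrt (lam n))
      + 2 * (exp (- 2 * lam n) * ((sqrt (lam n) + 1) * exp (- (sqrt (real n) - sqrt pi)\<^sup>2) + pi / sqrt (lam n)))"
    (is "\<bar>_ - ?main\<bar> \<le> ?A + ?B + ?C + ?D")
proof -
  obtain \<delta> :: "nat \<Rightarrow> real" where \<delta>: "\<delta> \<longlonglongrightarrow> 0"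
    "\<And>M. norm (integral {1/2..real M + 1} (\<lambda>s. - (1 + \<i>) * of_real (real n / (2 * s\<^sup>2)) * bessel_phase n s) - leading n)
      \<le> ?D + \<delta> M"
    by (rule ray_integral_leading[OF n]) (rule that)
  have n1: "n \<ge> 1" and n2: "n \<ge> 2" using n by auto
  define S where "S M = integral {0..real M + 1/2} (\<lambda>t. ratio_deriv n t * sawtooth t)" for M :: nat
  have S: "\<bar>- pi * S M + Im (leading n)\<bar> \<le> ?A + ?B + ?C + ?D + (\<delta> M + real n / (real M + 1))" for M
  proof -
    \<comment> \<open>Any sequence in the open unit interval with limit 1 would serve; the shift by
      2 makes already the first member positive.\<close>
    define r :: "nat \<Rightarrow> real" where "r k = 1 - 1 / (real k + 2)" for k
    have r: "0 < r k" "r k < 1" for k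
      by (auto simp: r_def field_simps)
    have rlim: "r \<longlonglongrightarrow> 1" unfolding r_def by real_asymp
    define J where "J k = integral {0..real M + 1/2} (\<lambda>t. integrand n (r k) (of_real t))" for k
    have "norm (J k + of_real (r k) * leading n) \<le> ?A + ?B + ?C + ?D + (\<delta> M + real n / (real M + 1))" for k
    proof -
      define V where "V = integral {0..1/2} (\<lambda>y. integrand n (r k) (- (of_real y * \<i>)) * (- \<i>))"
      define R where "R = integral {1/2..real M + 1} (\<lambda>s. integrand n (r k) (ray s) * (1 - \<i>))"
      define H where "H = integral {0..real M + 1} (\<lambda>y. integrand n (r k) (of_real (real M + 1/2) - of_real y * \<i>)) * \<i>"
      define G where "G = integral {1/2..real M + 1} (\<lambda>s. ratio_deriv n (ray s) * wave s * (1 - \<i>))"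
      define Q where "Q = integral {1/2..real M + 1} (\<lambda>s. - (1 + \<i>) * of_real (real n / (2 * s\<^sup>2)) * bessel_phase n s)"
      have "J k = V + R + H"
        unfolding J_def V_def R_def H_def ray_def by (rule rotate_contour[OF r])
      then have "J k + of_real (r k) * leading n =
          V + H + (R + of_real (r k) * G) - of_real (r k) * (G - Q) - of_real (r k) * (Q - leading n)"
        by (simp add: algebra_simps)
      also have "norm \<dots> \<le> norm V + norm H + norm (R + of_real (r k) * G) + norm (G - Q) + norm (Q - leading n)"
      proof -
        have "norm (of_real (r k) * z) \<le> norm z" for z :: complex
          using r[of k] by (simp add: norm_mult mult_left_le_one_le)
        from this[of "G - Q"] this[of "Q - leading n"] show ?thesis
          by (intro order_trans[OF norm_triangle_ineq4] add_mono order_trans[OF norm_triangle_ineq] order_refl)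
      qed
      also have "\<dots> \<le> ?A + real n / (real M + 1) + ?B + ?C + (?D + \<delta> M)"
      proof (intro add_mono)
        show "norm V \<le> ?A"
          unfolding V_def by (rule norm_integral_initial_le[OF r n2])
        show "norm H \<le> real n / (real M + 1)"
          unfolding H_def norm_mult using norm_integral_vertical_end_le[OF r n1] by simp
        show "norm (R + of_real (r k) * G) \<le> ?B"
          unfolding R_def G_def by (rule norm_integral_ray_linear_le[OF r n1]) simp
        show "norm (G - Q) \<le> ?C"
          unfolding G_def Q_def by (rule norm_integral_ray_approx_le[OF n1]) simp
        show "norm (Q - leading n) \<le> ?D + \<delta> M"
          unfolding Q_def by (rule \<delta>(2))
      qed
      finally show ?thesis by simp
    qed
    moreover have "\<bar>Im (J k) + r k * Im (leading n)\<bar> \<le> norm (J k + of_real (r k) * leading n)" for k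
      using abs_Im_le_cmod[of "J k + of_real (r k) * leading n"] by simp
    ultimately have le: "\<bar>Im (J k) + r k * Im (leading n)\<bar> \<le> ?A + ?B + ?C + ?D + (\<delta> M + real n / (real M + 1))" for k
      using order_trans by blast
    have "(\<lambda>k. Im (J k)) \<longlonglongrightarrow> - pi * S M"
    proof -
      have c: "continuous_on {0..real M + 1/2} (ratio_deriv n :: real \<Rightarrow> real)"
        unfolding ratio_deriv_def[abs_def] by (intro continuous_intros) auto
      have "complex_of_real (ratio_deriv n t) = ratio_deriv n (of_real t)" for t :: real
        by (simp add: ratio_deriv_def)
      then show ?thesis
        using sawtooth_integral_limit[OF c r rlim] by (simp add: J_def S_def integrand_def log_kernel_def)
    qed
    then have "(\<lambda>k. \<bar>Im (J k) + r k * Im (leading n)\<bar>) \<longlonglongrightarrow> \<bar>- pi * S M + 1 * Im (leading n)\<bar>"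
      by (intro tendsto_intros rlim)
    from tendsto_upperbound[OF this always_eventually] le show ?thesis by simp
  qed
  have "(\<lambda>M. \<bar>- pi * S M + Im (leading n)\<bar>) \<longlonglongrightarrow> \<bar>- pi * newton_coeff n + Im (leading n)\<bar>"
    using newton_coeff_sawtooth[OF n1] unfolding S_def by (intro tendsto_intros)
  moreover have "(\<lambda>M. ?A + ?B + ?C + ?D + (\<delta> M + real n / (real M + 1))) \<longlonglongrightarrow> ?A + ?B + ?C + ?D + (0 + 0)"
  proof (intro tendsto_add tendsto_const \<delta>)
    show "(\<lambda>M. real n / (real M + 1)) \<longlonglongrightarrow> 0" by real_asymp
  qed
  ultimately have "\<bar>- pi * newton_coeff n + Im (leading n)\<bar> \<le> ?A + ?B + ?C + ?D + (0 + 0)"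
    by (rule LIMSEQ_le) (use S in auto)
  moreover have "- pi * newton_coeff n + Im (leading n) = - (pi * (newton_coeff n - ?main))"
    unfolding Im_leading[OF n1] by (simp add: algebra_simps)
  ultimately have "pi * \<bar>newton_coeff n - ?main\<bar> \<le> ?A + ?B + ?C + ?D"
    by (simp add: abs_mult)
  moreover have "1 * \<bar>newton_coeff n - ?main\<bar> \<le> pi * \<bar>newton_coeff n - ?main\<bar>"
    using pi_gt3 by (intro mult_right_mono) auto
  ultimately have "1 * \<bar>newton_coeff n - ?main\<bar> \<le> ?A + ?B + ?C + ?D"
    by (rule order_trans[rotated])
  then show ?thesis by (simp only: mult_1)
qed

theorem theorem1:
  shows "(\<lambda>n::nat. newton_coeff n -
            (2 * real n / pi) powr (1 / 4) * exp (- 2 * sqrt (pi * real n))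
              * cos (2 * sqrt (pi * real n) - 5 * pi / 8))
         \<in> O[sequentially](\<lambda>n. exp (- 2 * sqrt (pi * real n)) * real n powr (- 1 / 4))"
    (is "?f \<in> O(?g)")
proof -
  define A where "A n = 2 * real n * (1/2) ^ n" for n :: nat
  define B where "B n = 8 * exp (3 * pi / 4) * real n * exp (- 2 * sqrt (3 * pi * real n / 2))" for n :: nat
  define C where "C n = approx_const * pi * (exp (- 2 * lam n) / sqrt (lam n))" for n
  define D where "D n = 2 * (exp (- 2 * lam n) * ((sqrt (lam n) + 1) * exp (- (sqrt (real n) - sqrt pi)\<^sup>2) + pi / sqrt (lam n)))" for n
  have "A \<in> O(?g)" unfolding A_def by real_asymp
  moreover have "B \<in> O(?g)"
  proof -
    define d where "d = sqrt pi"
    \<comment> \<open>The excess rate e is positive because 3 pi / 2 > pi. Once the common factor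
      exp (- 2 d sqrt n) is split off, exp (- 2 e sqrt n) outweighs every power of n.\<close>
    define e where "e = sqrt (3 * pi / 2) - d"
    have "sqrt pi < sqrt (3 * pi / 2)" by (intro real_sqrt_less_mono) simp
    then have "e > 0" "d > 0" by (simp_all add: e_def d_def)
    then have "(\<lambda>n. 8 * exp (3 * pi / 4) * real n * exp (- (2 * e) * sqrt (real n))) \<in> O(\<lambda>n. real n powr (- 1 / 4))"
      by real_asymp
    from landau_o.big.mult_left[OF this, of "\<lambda>n. exp (- (2 * d) * sqrt (real n))"]
    have "(\<lambda>n. 8 * exp (3 * pi / 4) * real n * exp (- 2 * ((d + e) * sqrt (real n))))
        \<in> O(\<lambda>n. exp (- 2 * (d * sqrt (real n))) * real n powr (- 1 / 4))"
      by (simp add: exp_add[symmetric] algebra_simps)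
    moreover have "sqrt (pi * real n) = d * sqrt (real n)" for n
      by (simp add: d_def real_sqrt_mult)
    moreover have "sqrt (3 * pi * real n / 2) = (d + e) * sqrt (real n)" for n
    proof -
      have "3 * pi * real n / 2 = (3 * pi / 2) * real n" by simp
      then show ?thesis unfolding e_def by (simp only: real_sqrt_mult) simp
    qed
    ultimately show ?thesis unfolding B_def by (simp only:)
  qed
  \<comment> \<open>Here 1 / sqrt (lam n) = (pi n)^(-1/4) gives precisely the claimed order; the
    same term occurs in D, whose other part carries an additional Gaussian factor.\<close>
  moreover have "C \<in> O(?g)" unfolding C_def lam_def using approx_const_pos by real_asymp
  moreover have "D \<in> O(?g)" unfolding D_def lam_def by real_asymp
  ultimately have "(\<lambda>n. A n + B n + C n + D n) \<in> O(?g)"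
    by (intro sum_in_bigo)
  moreover have "?f \<in> O(\<lambda>n. A n + B n + C n + D n)"
  proof (rule bigoI[where c = 1])
    show "\<forall>\<^sub>F n in sequentially. norm (?f n) \<le> 1 * norm (A n + B n + C n + D n)"
      using eventually_ge_at_top[of 9]
    proof eventually_elim
      case (elim n)
      have "\<bar>?f n\<bar> \<le> A n + B n + C n + D n"
        unfolding A_def B_def C_def D_def by (rule newton_coeff_approx[OF elim])
      then show ?case by simp
    qed
  qed
  ultimately show ?thesis using landau_o.big_trans by blast
qed

end
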